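(* For all integers $m\ge 1$, $k\ge 1$, $n\ge 2$, let $r_E(m,k,n)$ be the largest real number $r$ such that for every multicake $C$ with $m$ islands and every $n$ value-measures $V_1,\dots,V_n$ on $C$ there exists a $k$-feasible envy-free allocation $(Z_1,\dots,Z_n)$ of $C$ with $V_i(Z_i)\ge r\cdot V_i(C)$ for all $i\in\{1,\dots,n\}$. Then for every $m\ge1$, $k\ge1$: (a) when $n=2$: $\displaystyle r_E(m,k,n)=\min\left(\frac1n,\ \frac{k}{m+n-1}\right)$; (b) for any $n\ge 3$: $\displaystyle r_E(m,k,n)\ \ge\ \min\left(\frac1n,\ \frac{k}{m+nk-k}\right)$.
   Context: A multicake $C$ with $m$ islands is the union of $m$ pairwise-disjoint intervals of unit length on the real line; these $m$ intervals are the islands. A value-measure on $C$ is a function of the form $V(Z)=\int_{Z} v(x)\,dx$ for (measurable) $Z\subseteq C$, where $v:C\to\mathbb{R}_{\ge 0}$ is integrable. An allocation is a vector $(Z_1,\dots,Z_n)$ of pairwise-disjoint subsets of $C$; their union need not be all of $C$ (free disposal). An allocation is $k$-feasible if each $Z_i$ is the union of at most $k$ intervals, each contained in a single island. It is envy-free if $V_i(Z_i)\ge V_i(Z_j)$ for all $i,j\in\{1,\dots,n\}$. *)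

theory Defs
  imports "HOL-Analysis.Analysis"
begin

text \<open>
  A multicake is represented by its set \<open>\<I>\<close> of islands, since adjacent islands cannot be recovered
  from their union; the multicake as a subset of the line is \<open>\<Union>\<I>\<close>. Islands and pieces may be open,
  closed or half-open intervals; islands can touch at an endpoint as long as they are disjoint.
\<close>

definition multicake :: "nat \<Rightarrow> real set set \<Rightarrow> bool" where
  "multicake m \<I> \<longleftrightarrow>
     finite \<I> \<and> card \<I> = m \<and> disjoint \<I> \<and>
     (\<forall>I\<in>\<I>. is_interval I \<and> emeasure lborel I = 1)"

definition value_measure :: "real set \<Rightarrow> (real set \<Rightarrow> real) \<Rightarrow> bool" where
  "value_measure C V \<longleftrightarrow>
     (\<exists>v :: real \<Rightarrow> real. (\<forall>x\<in>C. 0 \<le> v x) \<and> set_integrable lebesgue C v \<and>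
        (\<forall>Z \<in> sets lebesgue. Z \<subseteq> C \<longrightarrow> V Z = (LINT x:Z|lebesgue. v x)))"

text \<open>Agents are indexed by \<open>{..<n}\<close>.\<close>

definition allocation :: "nat \<Rightarrow> real set \<Rightarrow> (nat \<Rightarrow> real set) \<Rightarrow> bool" where
  "allocation n C Z \<longleftrightarrow> (\<forall>i<n. Z i \<subseteq> C) \<and> disjoint_family_on Z {..<n}"

text \<open>The empty set is an interval in the sense of \<^const>\<open>is_interval\<close>, and a piece may be empty.\<close>

definition feasible :: "nat \<Rightarrow> nat \<Rightarrow> real set set \<Rightarrow> (nat \<Rightarrow> real set) \<Rightarrow> bool" where
  "feasible k n \<I> Z \<longleftrightarrow>
     (\<forall>i<n. \<exists>\<J>. finite \<J> \<and> card \<J> \<le> k \<and> (\<forall>J\<in>\<J>. is_interval J \<and> (\<exists>I\<in>\<I>. J \<subseteq> I)) \<and> Z i = \<Union>\<J>)"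

definition envy_free :: "nat \<Rightarrow> (nat \<Rightarrow> real set \<Rightarrow> real) \<Rightarrow> (nat \<Rightarrow> real set) \<Rightarrow> bool" where
  "envy_free n V Z \<longleftrightarrow> (\<forall>i<n. \<forall>j<n. V i (Z i) \<ge> V i (Z j))"

definition guaranteed :: "nat \<Rightarrow> nat \<Rightarrow> nat \<Rightarrow> real \<Rightarrow> bool" where
  "guaranteed m k n r \<longleftrightarrow>
     (\<forall>\<I> V. multicake m \<I> \<and> (\<forall>i<n. value_measure (\<Union>\<I>) (V i)) \<longrightarrow>
        (\<exists>Z. allocation n (\<Union>\<I>) Z \<and> feasible k n \<I> Z \<and> envy_free n V Z \<and>
             (\<forall>i<n. V i (Z i) \<ge> r * V i (\<Union>\<I>))))"

text \<open>
  This is a maximum rather than a supremum: to prove anything about the value of \<open>r\<^sub>E\<close>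
  one has to show that the maximum is attained.
\<close>

definition r\<^sub>E :: "nat \<Rightarrow> nat \<Rightarrow> nat \<Rightarrow> real" where
  "r\<^sub>E m k n = (GREATEST r. guaranteed m k n r)"

end

theory Submission
  imports Defs
begin

text \<open>
  Lower bounds. Concatenate the islands, in some order, to one interval of length \<open>m\<close>, and let an agent value a
  piece \<open>[s, t]\<close> of it by the best \<open>k\<close> of the island segments in this piece (\<open>bundle_value\<close>). These values
  are continuous in \<open>s\<close> and \<open>t\<close> and vanish on empty pieces, so there is a division into \<open>n\<close> consecutive
  pieces that is envy-free for them (\<open>approx_envy_free_cut\<close>). Giving each agent the best \<open>k\<close> segments
  of its own piece is feasible and envy-free for the original values. A piece that meets \<open>c\<close> islands is worth at
  most \<open>max k c / k\<close> times its best \<open>k\<close> segments, hence the ratio is at least \<open>k\<close> divided by the sum of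
  \<open>max k c\<close> over the pieces (\<open>allocation_of_cut\<close>). The \<open>n - 1\<close> cuts split islands into additional parts;
  counting them bounds that sum by the larger of \<open>n * k\<close> and \<open>m + (n - 1) * k\<close>, which is the bound for
  \<open>n \<ge> 3\<close>.

  For two agents the bound \<open>max (2 * k) (m + 1)\<close> on the sum is available. It is enough that both pieces meet at
  least \<open>k\<close> islands, or both at most \<open>k\<close>. If one agent cuts and the other one chooses, only the cutter has
  to be indifferent, and the islands can be ordered according to the values of the cutter so that the indifferent cut falls
  where it should (\<open>guaranteed_two\<close>). This is optimal when both agents value one island at \<open>2\<close> and the others at
  \<open>1\<close> (\<open>guaranteed_upper_bounds\<close>).

  The envy-free division rests on Brouwer's theorem for the simplex of piece lengths and on Hall's theorem. The
  former is derived from Kuhn's combinatorial lemma, because the dimension \<open>n - 1\<close> is a variable number and not a type.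
  Compactness of the set of endpoints (\<open>approximate_allocations_converge\<close>) has two uses: the division needs
  to be envy-free only approximately, and the largest guaranteed ratio exists.
\<close>

section \<open>Fixed points in a variable number of coordinates\<close>

lemma convergent_coordinates:
  fixes \<xi> :: "nat \<Rightarrow> 'a \<Rightarrow> real"
  assumes "finite S" "\<And>N i. i \<in> S \<Longrightarrow> \<bar>\<xi> N i\<bar> \<le> B"
  shows "\<exists>r x. strict_mono (r :: nat \<Rightarrow> nat) \<and> (\<forall>i\<in>S. (\<lambda>N. \<xi> (r N) i) \<longlonglongrightarrow> x i)"
  using assms
proof (induction S rule: finite_induct)
  case empty
  then show ?case using strict_mono_id by auto
next
  case (insert a S)
  then obtain r x where r: "strict_mono (r :: nat \<Rightarrow> nat)" "\<forall>i\<in>S. (\<lambda>N. \<xi> (r N) i) \<longlonglongrightarrow> x i"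
    by (metis insertCI)
  have "bounded (range (\<lambda>N. \<xi> (r N) a))"
    using insert.prems by (auto intro!: boundedI[where B = B])
  then obtain l s where s: "strict_mono (s :: nat \<Rightarrow> nat)" "((\<lambda>N. \<xi> (r N) a) \<circ> s) \<longlonglongrightarrow> l"
    using bounded_imp_convergent_subsequence by blast
  have "(\<lambda>N. \<xi> ((r \<circ> s) N) i) \<longlonglongrightarrow> (x(a := l)) i" if "i \<in> insert a S" for i
  proof (cases "i = a")
    case True
    then show ?thesis using s(2) by (simp add: o_def)
  next
    case False
    then have "(\<lambda>N. \<xi> (r N) i) \<longlonglongrightarrow> x i" using r that by auto
    from LIMSEQ_subseq_LIMSEQ[OF this s(1)] show ?thesis using False by (simp add: o_def)
  qed
  then show ?case using strict_mono_o[OF r(1) s(1)] by blast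
qed

lemma tendsto_Max_image:
  fixes f :: "'a \<Rightarrow> 'b \<Rightarrow> real"
  assumes "finite A" "A \<noteq> {}" "\<And>a. a \<in> A \<Longrightarrow> ((\<lambda>x. f a x) \<longlongrightarrow> l a) F"
  shows "((\<lambda>x. Max ((\<lambda>a. f a x) ` A)) \<longlongrightarrow> Max (l ` A)) F"
  using assms
proof (induction rule: finite_ne_induct)
  case (insert a A)
  then show ?case by (simp add: tendsto_max)
qed simp

text \<open>
  Continuity is expressed through sequences that converge in the first \<open>d\<close> coordinates: the dimension
  then is an ordinary number, and a function with this property cannot depend on later coordinates.
\<close>
definition coordinatewise_continuous :: "nat \<Rightarrow> (nat \<Rightarrow> real) set \<Rightarrow> ((nat \<Rightarrow> real) \<Rightarrow> real) \<Rightarrow> bool" where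
  "coordinatewise_continuous d X g \<longleftrightarrow>
     (\<forall>\<xi> x. (\<forall>N. \<xi> N \<in> X) \<longrightarrow> x \<in> X \<longrightarrow> (\<forall>i<d. (\<lambda>N. \<xi> N i) \<longlonglongrightarrow> x i) \<longrightarrow> (\<lambda>N. g (\<xi> N)) \<longlonglongrightarrow> g x)"

definition cube :: "nat \<Rightarrow> (nat \<Rightarrow> real) set" where
  "cube d = {x. \<forall>i<d. 0 \<le> x i \<and> x i \<le> 1}"

text \<open>
  Brouwer's fixed point theorem in a dimension that is a term. In a cell of the grid of mesh
  \<open>1 / Suc N\<close> that Kuhn's lemma provides, each coordinate \<open>h i x - x i\<close> is nonnegative at one point and
  nonpositive at another one. A limit of such cells is a fixed point.
\<close>
lemma brouwer_cube_nat:
  assumes cont: "\<And>i. i < d \<Longrightarrow> coordinatewise_continuous d (cube d) (h i)"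
    and range: "\<And>i x. i < d \<Longrightarrow> x \<in> cube d \<Longrightarrow> 0 \<le> h i x \<and> h i x \<le> 1"
  shows "\<exists>x\<in>cube d. \<forall>i<d. h i x = x i"
proof -
  define grid :: "nat \<Rightarrow> (nat \<Rightarrow> nat) \<Rightarrow> nat \<Rightarrow> real" where "grid N q = (\<lambda>i. real (q i) / real (Suc N))" for N q
  have grid_cube: "grid N q \<in> cube d" if "\<forall>i<d. q i \<le> Suc N" for N q
    using that by (auto simp: cube_def grid_def divide_simps)
  define P where "P N q r s \<longleftrightarrow> (\<forall>i<d. q i \<le> Suc N) \<and>
      (\<forall>i<d. (\<forall>j<d. q j \<le> r i j \<and> r i j \<le> q j + 1) \<and> (\<forall>j<d. q j \<le> s i j \<and> s i j \<le> q j + 1) \<and>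
         (\<forall>j<d. r i j \<le> Suc N) \<and> (\<forall>j<d. s i j \<le> Suc N) \<and>
         grid N (r i) i \<le> h i (grid N (r i)) \<and> grid N (s i) i \<ge> h i (grid N (s i)))" for N q r s
  have ex: "\<exists>q r s. P N q r s" for N
  proof -
    \<comment> \<open>On the face \<open>x i = 1\<close> the label must be 1, even at points where \<open>h i x = x i\<close>.\<close>
    define label where "label x i = (if grid N x i \<le> h i (grid N x) \<and> x i \<noteq> Suc N then 0 else (1::nat))" for x i
    have l0: "grid N x i \<le> h i (grid N x)" if "label x i = 0" for x i
      using that by (auto simp: label_def split: if_splits)
    have l1: "grid N x i \<ge> h i (grid N x)" if "label x i \<noteq> 0" "\<forall>i<d. x i \<le> Suc N" "i < d" for x i
      using that range[OF \<open>i < d\<close> grid_cube[OF that(2)]] by (auto simp: label_def grid_def split: if_splits)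
    obtain q where q: "\<forall>i<d. q i < Suc N" 
      and lab: "\<forall>i<d. \<exists>r s. (\<forall>j<d. q j \<le> r j \<and> r j \<le> q j + 1) \<and> (\<forall>j<d. q j \<le> s j \<and> s j \<le> q j + 1) \<and> label r i \<noteq> label s i"
    proof (rule kuhn_lemma[of "Suc N" d label])
      show "\<forall>x. (\<forall>i<d. x i \<le> Suc N) \<longrightarrow> (\<forall>i<d. x i = 0 \<longrightarrow> label x i = 0)"
        using range grid_cube by (auto simp: label_def grid_def)
      show "\<forall>x. (\<forall>i<d. x i \<le> Suc N) \<longrightarrow> (\<forall>i<d. x i = Suc N \<longrightarrow> label x i = 1)"
        by (auto simp: label_def)
      show "\<forall>x. (\<forall>i<d. x i \<le> Suc N) \<longrightarrow> (\<forall>i<d. label x i = (0::nat) \<or> label x i = 1)"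
        by (auto simp: label_def)
    qed simp
    define Q where "Q i r s \<longleftrightarrow> (\<forall>j<d. q j \<le> r j \<and> r j \<le> q j + 1) \<and> (\<forall>j<d. q j \<le> s j \<and> s j \<le> q j + 1) \<and>
             (\<forall>j<d. r j \<le> Suc N) \<and> (\<forall>j<d. s j \<le> Suc N) \<and>
             grid N r i \<le> h i (grid N r) \<and> grid N s i \<ge> h i (grid N s)" for i r s
    have exQ: "\<exists>r s. Q i r s" if i: "i < d" for i
    proof -
      obtain r s where rs: "\<forall>j<d. q j \<le> r j \<and> r j \<le> q j + 1" "\<forall>j<d. q j \<le> s j \<and> s j \<le> q j + 1" "label r i \<noteq> label s i"
        using lab i by blast
      have b: "\<forall>j<d. r j \<le> Suc N" "\<forall>j<d. s j \<le> Suc N" using q rs by force+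
      show ?thesis
      proof (cases "label r i = 0")
        case True
        then have "label s i \<noteq> 0" using rs by auto
        then show ?thesis unfolding Q_def using rs b l0[OF True] l1[of s i] i by blast
      next
        case False
        then have "label s i = 0" using rs(3) by (auto simp: label_def split: if_splits)
        then show ?thesis unfolding Q_def using rs b l0[of s i] l1[OF False] i by blast
      qed
    qed
    obtain r s where "\<And>i. i < d \<Longrightarrow> Q i (r i) (s i)" using exQ by metis
    then show ?thesis
      unfolding P_def Q_def using q by (intro exI[of _ q] exI[of _ r] exI[of _ s]) (simp add: less_imp_le)
  qed
  obtain q r s where P: "\<And>N. P N (q N) (r N) (s N)" using ex by metis
  have qb: "\<forall>i<d. q N i \<le> Suc N" for N
    using P[of N] unfolding P_def by blast
  have near: "\<forall>j<d. q N j \<le> r N i j \<and> r N i j \<le> q N j + 1"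
      "\<forall>j<d. q N j \<le> s N i j \<and> s N i j \<le> q N j + 1"
    and bd: "\<forall>j<d. r N i j \<le> Suc N" "\<forall>j<d. s N i j \<le> Suc N"
    and sgn: "grid N (r N i) i \<le> h i (grid N (r N i))" "grid N (s N i) i \<ge> h i (grid N (s N i))"
    if "i < d" for N i
    using P[of N] that unfolding P_def by blast+
  have "\<exists>\<rho> x. strict_mono (\<rho> :: nat \<Rightarrow> nat) \<and> (\<forall>i\<in>{..<d}. (\<lambda>N. grid (\<rho> N) (q (\<rho> N)) i) \<longlonglongrightarrow> x i)"
    using grid_cube[OF qb] by (intro convergent_coordinates[where B = 1]) (auto simp: cube_def abs_le_iff intro: order_trans[OF _ zero_le_one])
  then obtain \<rho> x where \<rho>: "strict_mono (\<rho> :: nat \<Rightarrow> nat)"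
    and lim: "\<And>i. i < d \<Longrightarrow> (\<lambda>N. grid (\<rho> N) (q (\<rho> N)) i) \<longlonglongrightarrow> x i" by auto
  have x: "x \<in> cube d"
    unfolding cube_def
  proof (intro CollectI allI impI conjI)
    fix i assume i: "i < d"
    have "0 \<le> grid N (q N) i" "grid N (q N) i \<le> 1" for N
      using grid_cube[OF qb[of N]] i by (auto simp: cube_def)
    then show "0 \<le> x i" "x i \<le> 1"
      using LIMSEQ_le_const[OF lim[OF i]] LIMSEQ_le_const2[OF lim[OF i]] by blast+
  qed
  have squeeze: "(\<lambda>N. grid (\<rho> N) (p (\<rho> N)) j) \<longlonglongrightarrow> x j"
    if "\<And>N. \<forall>j<d. q N j \<le> p N j \<and> p N j \<le> q N j + 1" "j < d" for p j
  proof -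
    have "(\<lambda>N. 1 / real (Suc N)) \<longlonglongrightarrow> 0"
      using LIMSEQ_inverse_real_of_nat by (simp add: inverse_eq_divide)
    from LIMSEQ_subseq_LIMSEQ[OF this \<rho>] have z: "(\<lambda>N. 1 / real (Suc (\<rho> N))) \<longlonglongrightarrow> 0" by (simp add: o_def)
    have up: "(\<lambda>N. grid (\<rho> N) (q (\<rho> N)) j + 1 / real (Suc (\<rho> N))) \<longlonglongrightarrow> x j"
      using tendsto_add[OF lim[OF that(2)] z] by simp
    have b1: "grid N (q N) j \<le> grid N (p N) j" for N
      unfolding grid_def using that by (intro divide_right_mono) auto
    have b2: "grid N (p N) j \<le> grid N (q N) j + 1 / real (Suc N)" for N
    proof -
      have "p N j \<le> q N j + 1" using that by blast
      then have "real (p N j) \<le> real (q N j) + 1" by linarith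
      then show ?thesis
        unfolding grid_def add_divide_distrib[symmetric] by (intro divide_right_mono) auto
    qed
    show ?thesis
      by (rule tendsto_sandwich[OF _ _ lim[OF that(2)] up]) (intro always_eventually allI b1 b2)+
  qed
  have "h i x = x i" if i: "i < d" for i
  proof (rule antisym)
    have c: "(\<lambda>N. h i (grid (\<rho> N) (p (\<rho> N)))) \<longlonglongrightarrow> h i x"
      if "\<And>N. \<forall>j<d. q N j \<le> p N j \<and> p N j \<le> q N j + 1" "\<And>N. \<forall>j<d. p N j \<le> Suc N" for p
      using cont[OF i, unfolded coordinatewise_continuous_def, rule_format, of "\<lambda>N. grid (\<rho> N) (p (\<rho> N))" x]
        x squeeze[OF that(1)] grid_cube[OF that(2)] by simp
    show "h i x \<le> x i"
      using LIMSEQ_le[OF c squeeze, of "\<lambda>N. s N i" "\<lambda>N. s N i" i] near(2)[OF i] bd(2)[OF i] sgn(2)[OF i] i by blast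
    show "x i \<le> h i x"
      using LIMSEQ_le[OF squeeze c, of "\<lambda>N. r N i" i "\<lambda>N. r N i"] near(1)[OF i] bd(1)[OF i] sgn(1)[OF i] i by blast
  qed
  then show ?thesis using x by blast
qed

definition std_simplex :: "nat \<Rightarrow> (nat \<Rightarrow> real) set" where
  "std_simplex n = {x. (\<forall>i<n. 0 \<le> x i) \<and> (\<Sum>i<n. x i) = 1}"

lemma std_simplex_subset_cube: "std_simplex n \<subseteq> cube n"
proof
  fix x assume x: "x \<in> std_simplex n"
  have "x i \<le> 1" if "i < n" for i
    using x that member_le_sum[of i "{..<n}" x] by (auto simp: std_simplex_def)
  then show "x \<in> cube n" using x by (auto simp: std_simplex_def cube_def)
qed

text \<open>
  The cube retracts onto the simplex: raise all coordinates equally if their sum is below \<open>1\<close>, then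
  divide by the sum.
\<close>
lemma brouwer_simplex:
  assumes cont: "\<And>i. i < n \<Longrightarrow> coordinatewise_continuous n (std_simplex n) (h i)"
    and range: "\<And>x. x \<in> std_simplex n \<Longrightarrow> (\<lambda>i. h i x) \<in> std_simplex n"
    and "n > 0"
  shows "\<exists>x\<in>std_simplex n. \<forall>i<n. h i x = x i"
proof -
  define S where "S y = (\<Sum>i<n. y i)" for y :: "nat \<Rightarrow> real"
  define \<rho> where "\<rho> y = (\<lambda>j. (y j + max 0 (1 - S y) / real n) / max 1 (S y))" for y :: "nat \<Rightarrow> real"
  have \<rho>: "\<rho> y \<in> std_simplex n" if "y \<in> cube n" for y
  proof -
    have "(\<Sum>j<n. \<rho> y j) = (S y + real n * (max 0 (1 - S y) / real n)) / max 1 (S y)"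
      unfolding \<rho>_def sum_divide_distrib[symmetric] by (simp add: sum.distrib S_def)
    also have "\<dots> = 1" using \<open>n > 0\<close> by (auto simp: max_def)
    finally show ?thesis using that by (auto simp: std_simplex_def cube_def \<rho>_def intro!: divide_nonneg_nonneg add_nonneg_nonneg)
  qed
  have \<rho>_id: "\<rho> y = y" if "y \<in> std_simplex n" for y
    using that by (auto simp: \<rho>_def S_def std_simplex_def)
  have \<rho>_cont: "(\<lambda>N. \<rho> (\<xi> N) j) \<longlonglongrightarrow> \<rho> y j" if "\<forall>i<n. (\<lambda>N. \<xi> N i) \<longlonglongrightarrow> y i" "j < n" for \<xi> y j
  proof -
    have "(\<lambda>N. S (\<xi> N)) \<longlonglongrightarrow> S y" unfolding S_def using that by (intro tendsto_sum) auto
    then show ?thesis unfolding \<rho>_def using that \<open>n > 0\<close> by (intro tendsto_intros) auto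
  qed
  have "\<exists>y\<in>cube n. \<forall>i<n. h i (\<rho> y) = y i"
  proof (rule brouwer_cube_nat)
    show "coordinatewise_continuous n (cube n) (\<lambda>y. h i (\<rho> y))" if i: "i < n" for i
      unfolding coordinatewise_continuous_def
    proof (intro allI impI)
      fix \<xi> x assume a: "\<forall>N. \<xi> N \<in> cube n" "x \<in> cube n" "\<forall>i<n. (\<lambda>N. \<xi> N i) \<longlonglongrightarrow> x i"
      then show "(\<lambda>N. h i (\<rho> (\<xi> N))) \<longlonglongrightarrow> h i (\<rho> x)"
        using cont[OF i, unfolded coordinatewise_continuous_def, rule_format, of "\<lambda>N. \<rho> (\<xi> N)" "\<rho> x"]
          \<rho> \<rho>_cont[OF a(3)] by simp
    qed
    show "0 \<le> h i (\<rho> x) \<and> h i (\<rho> x) \<le> 1" if "i < n" "x \<in> cube n" for i x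
      using range[OF \<rho>[OF that(2)]] std_simplex_subset_cube[of n] that(1) by (auto simp: cube_def)
  qed
  then obtain y where y: "y \<in> cube n" "\<forall>i<n. h i (\<rho> y) = y i" by blast
  then have "y \<in> std_simplex n" using range[OF \<rho>[OF y(1)]] by (auto simp: std_simplex_def)
  then show ?thesis using y \<rho>_id by force
qed

text \<open>
  Up to the factor \<open>n\<close>, a map of the simplex that preserves its faces hits the barycentre. Add weight
  to the coordinates where \<open>g\<close> is below \<open>1\<close> and rescale. If some weight is added at a fixed point \<open>x\<close>,
  then a coordinate with \<open>g j x > 1\<close>, which has to exist, has weight \<open>0\<close>; but there
  \<open>g j x = 0\<close> by the face condition.
\<close>
lemma simplex_balance:
  assumes cont: "\<And>j. j < n \<Longrightarrow> coordinatewise_continuous n (std_simplex n) (g j)"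
    and tot: "\<And>x. x \<in> std_simplex n \<Longrightarrow> (\<Sum>j<n. g j x) = real n"
    and face: "\<And>j x. j < n \<Longrightarrow> x \<in> std_simplex n \<Longrightarrow> x j = 0 \<Longrightarrow> g j x = 0"
    and "n > 0"
  shows "\<exists>x\<in>std_simplex n. \<forall>j<n. g j x = 1"
proof -
  define e where "e j x = max 0 (1 - g j x)" for j x
  define S where "S x = (\<Sum>j<n. e j x)" for x
  define h where "h j x = (x j + e j x) / (1 + S x)" for j x
  have e0: "e j x \<ge> 0" for j x by (simp add: e_def)
  have S0: "S x \<ge> 0" for x by (simp add: S_def e0 sum_nonneg)
  have "\<exists>x\<in>std_simplex n. \<forall>i<n. h i x = x i"
  proof (rule brouwer_simplex)
    show "coordinatewise_continuous n (std_simplex n) (h i)" if i: "i < n" for i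
      unfolding coordinatewise_continuous_def
    proof (intro allI impI)
      fix \<xi> x assume a: "\<forall>N. \<xi> N \<in> std_simplex n" "x \<in> std_simplex n" "\<forall>i<n. (\<lambda>N. \<xi> N i) \<longlonglongrightarrow> x i"
      have "(\<lambda>N. g j (\<xi> N)) \<longlonglongrightarrow> g j x" if "j < n" for j
        using cont[OF that] a unfolding coordinatewise_continuous_def by blast
      then have e: "(\<lambda>N. e j (\<xi> N)) \<longlonglongrightarrow> e j x" if "j < n" for j
        unfolding e_def using that by (intro tendsto_intros) auto
      then have "(\<lambda>N. S (\<xi> N)) \<longlonglongrightarrow> S x" unfolding S_def by (intro tendsto_sum) auto
      moreover have "1 + S x \<noteq> 0" using S0[of x] by linarith
      ultimately show "(\<lambda>N. h i (\<xi> N)) \<longlonglongrightarrow> h i x"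
        unfolding h_def using e[OF i] a(3) i by (intro tendsto_intros) auto
    qed
    show "(\<lambda>i. h i x) \<in> std_simplex n" if x: "x \<in> std_simplex n" for x
    proof -
      have "(\<Sum>j<n. h j x) = ((\<Sum>j<n. x j) + S x) / (1 + S x)"
        by (simp add: h_def sum_divide_distrib[symmetric] sum.distrib S_def)
      also have "\<dots> = 1" using x S0[of x] by (auto simp: std_simplex_def)
      finally show ?thesis using x e0 S0[of x] by (auto simp: std_simplex_def h_def intro!: divide_nonneg_nonneg)
    qed
  qed fact
  then obtain x where x: "x \<in> std_simplex n" and fp: "\<And>i. i < n \<Longrightarrow> h i x = x i" by blast
  have eq: "x j * S x = e j x" if "j < n" for j
    using fp[OF that] S0[of x] by (simp add: h_def field_simps)
  have le: "g j x \<le> 1" if j: "j < n" for j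
  proof (rule ccontr)
    assume "\<not> g j x \<le> 1"
    then have gj: "g j x > 1" by simp
    then have "x j \<noteq> 0" using face[OF j x] by auto
    then have "S x = 0" using eq[OF j] gj by (auto simp: e_def)
    then have "e i x = 0" if "i < n" for i using eq[OF that] by simp
    then have "g i x \<ge> 1" if "i < n" for i using that by (force simp: e_def max_def split: if_splits)
    then have "(\<Sum>i<n. g i x) > (\<Sum>i<n. 1)"
      using gj j by (intro sum_strict_mono_ex1) auto
    then show False using tot[OF x] by simp
  qed
  have "(\<Sum>j<n. 1 - g j x) = 0" using tot[OF x] by (simp add: sum_subtractf)
  then have "\<forall>j\<in>{..<n}. 1 - g j x = 0" using le by (subst (asm) sum_nonneg_eq_0_iff) auto
  then show ?thesis using x by auto
qed

section \<open>Envy-free cuts of an interval\<close>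

text \<open>
  Hall's marriage theorem, by shrinking the sets while Hall's condition persists. If a set contains two
  elements and neither can be dropped, then two families of indices witness this, and counting their union
  and their intersection contradicts Hall's condition.
\<close>
lemma marriage:
  fixes A :: "'a \<Rightarrow> 'b set"
  assumes "finite S" "\<And>i. i \<in> S \<Longrightarrow> finite (A i)"
    and hall: "\<And>I. I \<subseteq> S \<Longrightarrow> card I \<le> card (\<Union>i\<in>I. A i)"
  shows "\<exists>f. inj_on f S \<and> (\<forall>i\<in>S. f i \<in> A i)"
  using assms(2,3)
proof (induction "\<Sum>i\<in>S. card (A i)" arbitrary: A rule: less_induct)
  case less
  show ?case
  proof (cases "\<forall>i\<in>S. card (A i) = 1")
    case True
    then have "\<forall>i\<in>S. \<exists>y. A i = {y}" by (simp add: card_1_singleton_iff)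
    then obtain f where f: "\<And>i. i \<in> S \<Longrightarrow> A i = {f i}" by metis
    have "inj_on f S"
    proof (rule inj_onI, rule ccontr)
      fix i j assume ij: "i \<in> S" "j \<in> S" "f i = f j" "i \<noteq> j"
      then have "card {i, j} \<le> card (\<Union>k\<in>{i,j}. A k)" by (intro less.prems) auto
      then show False using ij f by simp
    qed
    then show ?thesis using f by auto
  next
    case False
    then obtain a where a: "a \<in> S" "card (A a) \<noteq> 1" by blast
    have "card {a} \<le> card (\<Union>k\<in>{a}. A k)" using a by (intro less.prems) auto
    then have "card (A a) \<ge> 2" using a by auto
    then obtain x y where xy: "x \<in> A a" "y \<in> A a" "x \<noteq> y"
      by (metis card_le_Suc0_iff_eq less.prems(1)[OF a(1)] not_less_eq_eq numeral_2_eq_2)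
    define B where "B z = A(a := A a - {z})" for z
    have smaller: "(\<Sum>i\<in>S. card (B z i)) < (\<Sum>i\<in>S. card (A i))" if "z \<in> A a" for z
    proof (rule sum_strict_mono_ex1)
      show "\<forall>i\<in>S. card (B z i) \<le> card (A i)"
        using less.prems(1) by (auto simp: B_def intro: card_mono)
      show "\<exists>i\<in>S. card (B z i) < card (A i)"
        using a(1) card_Diff1_less[OF less.prems(1)[OF a(1)] that] by (intro bexI[of _ a]) (simp_all add: B_def)
    qed (use assms in auto)
    have step: ?thesis if z: "z \<in> A a" and h: "\<And>I. I \<subseteq> S \<Longrightarrow> card I \<le> card (\<Union>i\<in>I. B z i)" for z
    proof -
      have fin: "finite (B z i)" if "i \<in> S" for i
        using less.prems(1)[OF that] by (auto simp: B_def)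
      obtain f where "inj_on f S" "\<forall>i\<in>S. f i \<in> B z i"
        using less.hyps[OF smaller[OF z] fin h] by blast
      moreover have "B z i \<subseteq> A i" for i by (auto simp: B_def)
      ultimately show ?thesis by blast
    qed
    have bad: "\<exists>I. I \<subseteq> S - {a} \<and> card ((\<Union>i\<in>I. A i) \<union> (A a - {z})) \<le> card I"
      if "\<not> (\<forall>I. I \<subseteq> S \<longrightarrow> card I \<le> card (\<Union>i\<in>I. B z i))" for z
    proof -
      from that obtain I where I: "I \<subseteq> S" "card (\<Union>i\<in>I. B z i) < card I" by (meson not_less)
      have "a \<in> I"
      proof (rule ccontr)
        assume "a \<notin> I"
        then have "(\<Union>i\<in>I. B z i) = (\<Union>i\<in>I. A i)" by (auto simp: B_def)
        then show False using I less.prems(2)[OF I(1)] by simp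
      qed
      then have eq: "(\<Union>i\<in>I. B z i) = (\<Union>i\<in>I - {a}. A i) \<union> (A a - {z})" by (auto simp: B_def)
      have "finite I" using I assms(1) finite_subset by blast
      then have "card I = Suc (card (I - {a}))" using \<open>a \<in> I\<close> by (metis card.remove)
      then show ?thesis using I eq by (intro exI[of _ "I - {a}"]) auto
    qed
    show ?thesis
    proof (cases "(\<forall>I. I \<subseteq> S \<longrightarrow> card I \<le> card (\<Union>i\<in>I. B x i)) \<or> (\<forall>I. I \<subseteq> S \<longrightarrow> card I \<le> card (\<Union>i\<in>I. B y i))")
      case True
      then show ?thesis using step xy by blast
    next
      case False
      obtain I where I: "I \<subseteq> S - {a}" "card ((\<Union>i\<in>I. A i) \<union> (A a - {x})) \<le> card I"
        using bad[of x] False by blast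
      obtain J where J: "J \<subseteq> S - {a}" "card ((\<Union>i\<in>J. A i) \<union> (A a - {y})) \<le> card J"
        using bad[of y] False by blast
      define P where "P = (\<Union>i\<in>I. A i) \<union> (A a - {x})"
      define Q where "Q = (\<Union>i\<in>J. A i) \<union> (A a - {y})"
      have fin: "finite I" "finite J" using I J assms(1) finite_subset by blast+
      have finPQ: "finite P" "finite Q" unfolding P_def Q_def using fin I(1) J(1) a less.prems(1) by auto
      have "card (insert a (I \<union> J)) \<le> card (\<Union>i\<in>insert a (I \<union> J). A i)"
        using a I J by (intro less.prems) auto
      also have "(\<Union>i\<in>insert a (I \<union> J). A i) = P \<union> Q" using xy by (auto simp: P_def Q_def)
      finally have 1: "Suc (card (I \<union> J)) \<le> card (P \<union> Q)" using fin I J by (subst (asm) card_insert_disjoint) auto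
      have "card (I \<inter> J) \<le> card (\<Union>i\<in>I \<inter> J. A i)" using I J by (intro less.prems) auto
      also have "\<dots> \<le> card (P \<inter> Q)" using finPQ by (intro card_mono) (auto simp: P_def Q_def)
      finally have 2: "card (I \<inter> J) \<le> card (P \<inter> Q)" .
      have "card P \<le> card I" "card Q \<le> card J" using I J by (auto simp: P_def Q_def)
      then show ?thesis using 1 2 card_Un_Int[OF fin] card_Un_Int[OF finPQ] by linarith
    qed
  qed
qed

text \<open>
  The part of Birkhoff's theorem that matters here. Hall's condition holds because the total weight of
  the rows in \<open>I\<close>, namely \<open>card I\<close>, lies in columns that carry weight \<open>1\<close> each.
\<close>
lemma doubly_stochastic_transversal:
  fixes p :: "nat \<Rightarrow> nat \<Rightarrow> real"
  assumes nonneg: "\<And>i j. i < n \<Longrightarrow> j < n \<Longrightarrow> p i j \<ge> 0"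
    and row: "\<And>i. i < n \<Longrightarrow> (\<Sum>j<n. p i j) = 1"
    and col: "\<And>j. j < n \<Longrightarrow> (\<Sum>i<n. p i j) = 1"
  shows "\<exists>\<pi>. bij_betw \<pi> {..<n} {..<n} \<and> (\<forall>i<n. p i (\<pi> i) > 0)"
proof -
  define A where "A i = {j. j < n \<and> p i j > 0}" for i
  have "\<exists>f. inj_on f {..<n} \<and> (\<forall>i\<in>{..<n}. f i \<in> A i)"
  proof (rule marriage)
    fix I :: "nat set" assume I: "I \<subseteq> {..<n}"
    define B where "B = (\<Union>i\<in>I. A i)"
    have B: "B \<subseteq> {..<n}" by (auto simp: B_def A_def)
    have "real (card I) = (\<Sum>i\<in>I. \<Sum>j<n. p i j)" using row I by (simp add: subset_iff)
    also have "\<dots> = (\<Sum>i\<in>I. \<Sum>j\<in>B. p i j)"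
    proof (rule sum.cong[OF refl], rule sum.mono_neutral_right)
      fix i assume "i \<in> I"
      then show "\<forall>j\<in>{..<n} - B. p i j = 0"
        using nonneg I by (force simp: B_def A_def)
    qed (use B in auto)
    also have "\<dots> = (\<Sum>j\<in>B. \<Sum>i\<in>I. p i j)" by (rule sum.swap)
    also have "\<dots> \<le> (\<Sum>j\<in>B. \<Sum>i<n. p i j)"
      using I B nonneg by (intro sum_mono sum_mono2) auto
    also have "\<dots> = real (card B)" using col B by (simp add: subset_iff)
    finally show "card I \<le> card (\<Union>i\<in>I. A i)" by (simp add: B_def)
  qed (auto simp: A_def)
  then obtain f where f: "inj_on f {..<n}" "\<And>i. i < n \<Longrightarrow> f i < n \<and> p i (f i) > 0"
    by (auto simp: A_def)
  then have "f ` {..<n} = {..<n}" by (intro endo_inj_surj) auto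
  then show ?thesis using f by (auto simp: bij_betw_def)
qed

text \<open>
  An envy-free division of \<open>[0, c]\<close> into \<open>n\<close> consecutive pieces, up to \<open>\<delta>\<close>. A point \<open>x\<close> of the simplex
  lists the relative lengths of the pieces. Each agent spreads one vote over the pieces that are nearly best for
  it. The votes received by an empty piece vanish, so by \<open>simplex_balance\<close> some \<open>x\<close> gives every piece
  exactly one vote; a transversal of the vote matrix then gives every agent a nearly best piece.
\<close>
lemma approx_envy_free_cut:
  fixes u :: "nat \<Rightarrow> real \<Rightarrow> real \<Rightarrow> real"
  assumes "n > 0" "c \<ge> 0" "\<delta> > 0"
    and cont: "\<And>i a b x y. i < n \<Longrightarrow> a \<longlonglongrightarrow> x \<Longrightarrow> b \<longlonglongrightarrow> y \<Longrightarrow> (\<lambda>N. u i (a N) (b N)) \<longlonglongrightarrow> u i x y"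
    and nonneg: "\<And>i s t. i < n \<Longrightarrow> s \<le> t \<Longrightarrow> u i s t \<ge> 0"
    and empty: "\<And>i s. i < n \<Longrightarrow> u i s s = 0"
  shows "\<exists>t \<pi>. t 0 = 0 \<and> t n = c \<and> (\<forall>j<n. t j \<le> t (Suc j)) \<and> bij_betw \<pi> {..<n} {..<n} \<and>
           (\<forall>i<n. \<forall>j<n. u i (t j) (t (Suc j)) \<le> u i (t (\<pi> i)) (t (Suc (\<pi> i))) + \<delta>)"
proof -
  \<comment> \<open>With the bonus \<open>\<eta> * x j\<close> a best piece is worth at least \<open>\<eta> / n\<close>, an empty one nothing. Since the
    tolerance \<open>\<epsilon>\<close> is smaller, an empty piece never gets a vote.\<close>
  define \<eta> where "\<eta> = \<delta> / 2"
  define \<epsilon> where "\<epsilon> = \<eta> / (2 * real n)"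
  have pos: "\<eta> > 0" "\<epsilon> > 0" using assms by (auto simp: \<eta>_def \<epsilon>_def)
  have \<epsilon>\<eta>: "\<epsilon> < \<eta> / n" "\<epsilon> \<le> \<eta>" using assms by (auto simp: \<eta>_def \<epsilon>_def field_simps)
  define cut where "cut x j = c * (\<Sum>l<j. x l)" for x :: "nat \<Rightarrow> real" and j
  define a where "a i j x = u i (cut x j) (cut x (Suc j)) + \<eta> * x j" for i j x
  define M where "M i x = Max ((\<lambda>j. a i j x) ` {..<n})" for i x
  define f where "f i j x = max 0 (a i j x - (M i x - \<epsilon>))" for i j x
  define F where "F i x = (\<Sum>j<n. f i j x)" for i x
  define g where "g j x = (\<Sum>i<n. f i j x / F i x)" for j x
  have aM: "a i j x \<le> M i x" if "j < n" for i j x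
    unfolding M_def using that by (intro Max_ge) auto
  have Mex: "\<exists>j<n. M i x = a i j x" for i x
  proof -
    have "M i x \<in> (\<lambda>j. a i j x) ` {..<n}" unfolding M_def using \<open>n > 0\<close> by (intro Max_in) auto
    then show ?thesis by blast
  qed
  have f0: "f i j x \<ge> 0" for i j x by (simp add: f_def)
  have F0: "F i x > 0" for i x
  proof -
    obtain j where "j < n" "M i x = a i j x" using Mex by blast
    then have "f i j x > 0" using pos by (simp add: f_def)
    then show ?thesis unfolding F_def using \<open>j < n\<close> f0 by (intro sum_pos2[of _ j]) auto
  qed
  have cut_mono: "cut x j \<le> cut x (Suc j)" if "x \<in> std_simplex n" "j < n" for x j
    using that \<open>c \<ge> 0\<close> by (auto simp: cut_def std_simplex_def intro!: mult_left_mono)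
  have Mbig: "M i x \<ge> \<eta> / n" if x: "x \<in> std_simplex n" and i: "i < n" for i x
  proof -
    have "\<exists>j<n. x j \<ge> 1 / n"
    proof (rule ccontr)
      assume "\<not> ?thesis"
      then have "(\<Sum>j<n. x j) < (\<Sum>j<n. 1 / n)" using \<open>n > 0\<close> by (intro sum_strict_mono) auto
      then show False using x \<open>n > 0\<close> by (simp add: std_simplex_def)
    qed
    then obtain j where j: "j < n" "x j \<ge> 1 / n" by blast
    have "\<eta> / n \<le> \<eta> * x j" using mult_left_mono[OF j(2), of \<eta>] pos by simp
    also have "\<dots> \<le> a i j x" using nonneg[OF i cut_mono[OF x j(1)]] by (simp add: a_def)
    also have "\<dots> \<le> M i x" using aM j by blast
    finally show ?thesis .
  qed
  have "\<exists>x\<in>std_simplex n. \<forall>j<n. g j x = 1"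
  proof (rule simplex_balance)
    show "coordinatewise_continuous n (std_simplex n) (g j)" if j: "j < n" for j
      unfolding coordinatewise_continuous_def
    proof (intro allI impI)
      fix \<xi> :: "nat \<Rightarrow> nat \<Rightarrow> real" and x assume "\<forall>i<n. (\<lambda>N. \<xi> N i) \<longlonglongrightarrow> x i"
      then have lim: "(\<lambda>N. \<xi> N i) \<longlonglongrightarrow> x i" if "i < n" for i using that by blast
      have cut: "(\<lambda>N. cut (\<xi> N) l) \<longlonglongrightarrow> cut x l" if "l \<le> n" for l
        unfolding cut_def using that lim by (intro tendsto_intros) auto
      have a: "(\<lambda>N. a i l (\<xi> N)) \<longlonglongrightarrow> a i l x" if "i < n" "l < n" for i l
        unfolding a_def using that by (intro tendsto_intros cont cut lim) auto
      have "(\<lambda>N. M i (\<xi> N)) \<longlonglongrightarrow> M i x" if "i < n" for i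
        unfolding M_def using that a \<open>n > 0\<close> by (intro tendsto_Max_image) auto
      then have f: "(\<lambda>N. f i l (\<xi> N)) \<longlonglongrightarrow> f i l x" if "i < n" "l < n" for i l
        unfolding f_def using that a by (intro tendsto_intros) auto
      then have "(\<lambda>N. F i (\<xi> N)) \<longlonglongrightarrow> F i x" if "i < n" for i
        unfolding F_def using that by (intro tendsto_intros) auto
      then show "(\<lambda>N. g j (\<xi> N)) \<longlonglongrightarrow> g j x"
        unfolding g_def using f j F0 by (intro tendsto_intros) (auto simp: less_imp_neq[THEN not_sym])
    qed
    show "(\<Sum>j<n. g j x) = real n" for x
    proof -
      have "(\<Sum>j<n. g j x) = (\<Sum>i<n. \<Sum>j<n. f i j x / F i x)"
        unfolding g_def by (rule sum.swap)
      also have "\<dots> = (\<Sum>i<n. 1)"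
        using F0 by (intro sum.cong) (auto simp: sum_divide_distrib[symmetric] F_def[symmetric] less_imp_neq[THEN not_sym])
      finally show ?thesis by simp
    qed
    show "g j x = 0" if j: "j < n" and x: "x \<in> std_simplex n" and z: "x j = 0" for j x
    proof -
      have "f i j x = 0" if "i < n" for i
        using empty[OF that] Mbig[OF x that] \<epsilon>\<eta> z by (simp add: f_def a_def cut_def)
      then show ?thesis by (simp add: g_def)
    qed
  qed fact
  then obtain x where x: "x \<in> std_simplex n" and g: "\<And>j. j < n \<Longrightarrow> g j x = 1" by blast
  have "\<exists>\<pi>. bij_betw \<pi> {..<n} {..<n} \<and> (\<forall>i<n. f i (\<pi> i) x / F i x > 0)"
  proof (rule doubly_stochastic_transversal)
    show "(\<Sum>j<n. f i j x / F i x) = 1" for i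
      using F0[of i x] by (simp add: sum_divide_distrib[symmetric] F_def[symmetric])
    show "0 \<le> f i j x / F i x" for i j using f0[of i j x] F0[of i x] by simp
  qed (use g in \<open>auto simp: g_def\<close>)
  then obtain \<pi> where \<pi>: "bij_betw \<pi> {..<n} {..<n}" and fpos: "\<And>i. i < n \<Longrightarrow> f i (\<pi> i) x / F i x > 0" by blast
  have "u i (cut x j) (cut x (Suc j)) \<le> u i (cut x (\<pi> i)) (cut x (Suc (\<pi> i))) + \<delta>" if i: "i < n" and j: "j < n" for i j
  proof -
    have \<pi>i: "\<pi> i < n" using \<pi> i by (auto simp: bij_betw_def)
    have "f i (\<pi> i) x > 0" using fpos[OF i] F0[of i x] by (simp add: zero_less_divide_iff)
    then have "a i (\<pi> i) x > M i x - \<epsilon>" by (simp add: f_def max_def split: if_splits)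
    then have "a i j x \<le> a i (\<pi> i) x + \<epsilon>" using aM[OF j, of i x] by simp
    moreover have "\<eta> * x (\<pi> i) \<le> \<eta> * 1"
      using std_simplex_subset_cube[of n] x \<pi>i pos by (intro mult_left_mono) (auto simp: cube_def)
    moreover have "0 \<le> \<eta> * x j" using x j pos by (simp add: std_simplex_def)
    moreover have "\<delta> = \<eta> + \<eta>" by (simp add: \<eta>_def)
    ultimately show ?thesis using \<epsilon>\<eta> by (simp add: a_def)
  qed
  moreover have "cut x 0 = 0" "cut x n = c" using x by (auto simp: cut_def std_simplex_def)
  ultimately show ?thesis using \<pi> cut_mono[OF x] by (intro exI[of _ "cut x"] exI[of _ \<pi>]) auto
qed

section \<open>Counting pieces of islands\<close>

text \<open>
  The \<open>k\<close> largest of \<open>c > k\<close> weights have at least the share \<open>k / c\<close> of the total. Removing a smallest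
  element preserves this.
\<close>
lemma best_subset_share:
  fixes w :: "'a \<Rightarrow> real"
  assumes "finite S" "\<And>x. x \<in> S \<Longrightarrow> w x \<ge> 0"
  shows "\<exists>L\<subseteq>S. card L \<le> k \<and> real k * sum w S \<le> real (max k (card S)) * sum w L"
proof (cases "card S \<le> k")
  case True
  then show ?thesis by (intro exI[of _ S]) auto
next
  case False
  have "\<exists>L\<subseteq>S. card L = k \<and> real k * sum w S \<le> real (card S) * sum w L"
    if "k \<le> card S" using assms that
  proof (induction "card S" arbitrary: S rule: less_induct)
    case less
    show ?case
    proof (cases "card S = k")
      case True
      then show ?thesis by (intro exI[of _ S]) auto
    next
      case False
      then have "S \<noteq> {}" using less.prems by auto
      then have "Min (w ` S) \<in> w ` S" using less.prems by (intro Min_in) auto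
      then obtain x where "x \<in> S" "w x = Min (w ` S)" by auto
      then have x: "x \<in> S" "\<And>y. y \<in> S \<Longrightarrow> w x \<le> w y"
        using less.prems(1) by auto
      have c: "card S = Suc (card (S - {x}))" using x less.prems(1) by (metis card.remove)
      then obtain L where L: "L \<subseteq> S - {x}" "card L = k" "real k * sum w (S - {x}) \<le> real (card (S - {x})) * sum w L"
        using less.hyps[of "S - {x}"] less.prems False by auto
      have "real k * w x = (\<Sum>y\<in>L. w x)" using L by simp
      also have "\<dots> \<le> sum w L" using L x by (intro sum_mono) auto
      finally have "real k * w x \<le> sum w L" .
      moreover have "sum w S = w x + sum w (S - {x})" using x less.prems(1) by (simp add: sum.remove)
      ultimately have "real k * sum w S \<le> real (card S) * sum w L"
        using L(3) unfolding c by (simp add: algebra_simps)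
      then show ?thesis using L by blast
    qed
  qed
  then show ?thesis using False by (auto simp: max_def)
qed

text \<open>
  The islands of the concatenated cake are the unit cells \<open>[l, l + 1]\<close>, \<open>l < m\<close>; these are the cells
  whose interior meets the piece \<open>[s, t]\<close>.
\<close>
definition met_unit_cells :: "nat \<Rightarrow> real \<Rightarrow> real \<Rightarrow> nat set" where
  "met_unit_cells m s t = {l. l < m \<and> s < real l + 1 \<and> real l < t}"

lemma finite_met_unit_cells [simp]: "finite (met_unit_cells m s t)"
  by (simp add: met_unit_cells_def)

lemma le_by_steps:
  fixes t :: "nat \<Rightarrow> real"
  assumes "\<And>j. j < n \<Longrightarrow> t j \<le> t (Suc j)" "i \<le> j" "j \<le> n"
  shows "t i \<le> t j"
  using assms(2,3)
proof (induction rule: dec_induct)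
  case (step k)
  then show ?case using assms(1)[of k] by linarith
qed simp

text \<open>
  Charge a pair of a piece \<open>j\<close> and a cell \<open>l\<close> to the piece if its left endpoint lies inside the cell
  and the piece is not the first one in \<open>B\<close>, and otherwise to the cell. Nothing is charged twice, so \<open>m\<close> cells
  and the \<open>card B - 1\<close> cuts that precede the later pieces bound the number of pairs.
\<close>
lemma sum_card_met_unit_cells:
  assumes mono: "\<And>j. j < n \<Longrightarrow> t j \<le> t (Suc j)" and B: "B \<subseteq> {..<n}" "B \<noteq> {}"
  shows "(\<Sum>j\<in>B. card (met_unit_cells m (t j) (t (Suc j)))) \<le> m + (card B - 1)"
proof -
  have le: "t i \<le> t j" if "i \<le> j" "j \<le> n" for i j
    using le_by_steps[of n t i j] mono that by blast
  have "finite B" using B finite_subset by blast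
  define j0 where "j0 = Min B"
  have j0: "j0 \<in> B" "\<And>j. j \<in> B \<Longrightarrow> j0 \<le> j" using \<open>finite B\<close> B by (auto simp: j0_def)
  define P where "P = (SIGMA j:B. met_unit_cells m (t j) (t (Suc j)))"
  define P1 where "P1 = {(j, l) \<in> P. j \<noteq> j0 \<and> real l < t j}"
  have "finite P" using \<open>finite B\<close> by (auto simp: P_def)
  have "inj_on fst P1"
  proof (rule inj_onI, clarify)
    fix j l j' l' assume "(j, l) \<in> P1" "(j', l') \<in> P1" "fst (j, l) = fst (j', l')"
    then have "real l < t j" "t j < real l + 1" "real l' < t j" "t j < real l' + 1" "j = j'"
      by (auto simp: P1_def P_def met_unit_cells_def)
    then show "j = j' \<and> l = l'" by linarith
  qed
  moreover have "fst ` P1 \<subseteq> B - {j0}" by (auto simp: P1_def P_def)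
  ultimately have "card P1 \<le> card (B - {j0})" using \<open>finite B\<close> by (intro card_inj_on_le) auto
  then have c1: "card P1 \<le> card B - 1" using j0 by (simp add: card_Diff_singleton)
  have no: False if "(j, l) \<in> P - P1" "(j', l) \<in> P - P1" "j < j'" for j j' l
  proof -
    have "j \<in> B" "j' \<in> B" "real l < t (Suc j)" using that by (auto simp: P_def met_unit_cells_def)
    then have "j' \<noteq> j0" using j0 that(3) by fastforce
    then have "t j' \<le> real l" using that by (auto simp: P1_def P_def)
    moreover have "t (Suc j) \<le> t j'" using that(3) \<open>j' \<in> B\<close> B by (intro le) auto
    ultimately show False using \<open>real l < t (Suc j)\<close> by linarith
  qed
  have "inj_on snd (P - P1)"
  proof (rule inj_onI)
    fix a b assume "a \<in> P - P1" "b \<in> P - P1" "snd a = snd b"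
    then show "a = b" using no[of "fst a" "snd a" "fst b"] no[of "fst b" "snd b" "fst a"]
      by (metis linorder_neqE_nat prod.collapse)
  qed
  moreover have "snd ` (P - P1) \<subseteq> {..<m}" by (auto simp: P_def met_unit_cells_def)
  ultimately have "card (P - P1) \<le> card {..<m}" by (intro card_inj_on_le) auto
  moreover have "card P = card P1 + card (P - P1)"
    using \<open>finite P\<close> by (subst card_Un_disjoint[symmetric]) (auto simp: P1_def intro: arg_cong[where f = card] finite_subset[of _ P])
  moreover have "card P = (\<Sum>j\<in>B. card (met_unit_cells m (t j) (t (Suc j))))"
    unfolding P_def using \<open>finite B\<close> by (subst card_SigmaI) auto
  ultimately show ?thesis using c1 by simp
qed

text \<open>
  Pieces that meet at most \<open>k\<close> islands contribute \<open>k\<close> each, and the count above is applied to the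
  set \<open>B\<close> of the others. Thus each piece, except for one in \<open>B\<close>, adds at most \<open>k\<close> to the \<open>m\<close> islands.
\<close>
lemma sum_max_card_met_unit_cells:
  assumes mono: "\<And>j. j < n \<Longrightarrow> t j \<le> t (Suc j)" and "k > 0" "n > 0"
  shows "(\<Sum>j<n. max k (card (met_unit_cells m (t j) (t (Suc j))))) \<le> max (n * k) (m + (n - 1) * k)"
proof -
  let ?c = "\<lambda>j. card (met_unit_cells m (t j) (t (Suc j)))"
  define B where "B = {j. j < n \<and> k < ?c j}"
  show ?thesis
  proof (cases "B = {}")
    case True
    then have "(\<Sum>j<n. max k (?c j)) = (\<Sum>j<n. k)" by (intro sum.cong) (auto simp: B_def max_def)
    then show ?thesis by simp
  next
    case False
    have B: "B \<subseteq> {..<n}" by (auto simp: B_def)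
    then have fin: "finite B" using finite_subset by blast
    obtain b where b: "card B = Suc b" using False fin by (metis card_0_eq not0_implies_Suc)
    have bn: "Suc b \<le> n" using card_mono[OF _ B] b by simp
    have "(\<Sum>j<n. max k (?c j)) = (\<Sum>j\<in>{..<n} - B. max k (?c j)) + (\<Sum>j\<in>B. max k (?c j))"
      using B by (intro sum.subset_diff) auto
    also have "(\<Sum>j\<in>{..<n} - B. max k (?c j)) = (\<Sum>j\<in>{..<n} - B. k)" by (intro sum.cong) (auto simp: B_def max_def)
    also have "\<dots> = (n - Suc b) * k" using B fin b by (simp add: card_Diff_subset)
    also have "(\<Sum>j\<in>B. max k (?c j)) = (\<Sum>j\<in>B. ?c j)" by (intro sum.cong) (auto simp: B_def max_def)
    also have "\<dots> \<le> m + b" using sum_card_met_unit_cells[where t = t, OF mono B False, of m] b by simp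
    also have "(n - Suc b) * k + (m + b) \<le> m + (n - 1) * k"
    proof -
      have "(n - 1) * k = (n - Suc b) * k + b * k" using bn by (simp add: add_mult_distrib[symmetric])
      moreover have "b \<le> b * k" using \<open>k > 0\<close> by simp
      ultimately show ?thesis by linarith
    qed
    finally show ?thesis by simp
  qed
qed

text \<open>
  Take the elements in pairs, and always give the larger element of a pair to the side that is behind.
\<close>
lemma balanced_bipartition:
  fixes w :: "'a \<Rightarrow> real"
  assumes "finite S" "card S \<le> 2 * p" "\<And>x. x \<in> S \<Longrightarrow> 0 \<le> w x \<and> w x \<le> M" "M \<ge> 0"
  shows "\<exists>A B. A \<union> B = S \<and> A \<inter> B = {} \<and> card A \<le> p \<and> card B \<le> p \<and> \<bar>sum w A - sum w B\<bar> \<le> M"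
  using assms(1-3)
proof (induction p arbitrary: S)
  case 0
  then show ?case using \<open>M \<ge> 0\<close> by (intro exI[of _ "{}"]) auto
next
  case (Suc p)
  show ?case
  proof (cases "card S \<le> 1")
    case True
    have "\<bar>sum w S\<bar> \<le> M"
    proof (cases "S = {}")
      case False
      then have "card S = 1" using True Suc.prems(1) by (simp add: le_Suc_eq)
      then obtain x where "S = {x}" by (metis card_1_singletonE)
      then show ?thesis using Suc.prems(3) by simp
    qed (simp add: \<open>M \<ge> 0\<close>)
    then show ?thesis using True by (intro exI[of _ S] exI[of _ "{}"]) auto
  next
    case False
    then obtain x y where xy: "x \<in> S" "y \<in> S" "x \<noteq> y"
      using Suc.prems(1) by (metis One_nat_def card_le_Suc0_iff_eq)
    have "card (S - {x, y}) = card S - 2" using xy Suc.prems(1) by (subst card_Diff_subset) auto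
    then have c: "card (S - {x, y}) \<le> 2 * p" using Suc.prems(2) by simp
    obtain A B where AB: "A \<union> B = S - {x, y}" "A \<inter> B = {}" "card A \<le> p" "card B \<le> p" "\<bar>sum w A - sum w B\<bar> \<le> M"
      using Suc.IH[of "S - {x, y}", OF _ c] Suc.prems by auto
    have fin: "finite A" "finite B" using AB(1) Suc.prems(1) by (metis finite_Diff finite_Un)+
    have nin: "x \<notin> A" "y \<notin> A" "x \<notin> B" "y \<notin> B" using AB(1) by auto
    have ins: ?thesis if "\<bar>(w a + sum w A) - (w b + sum w B)\<bar> \<le> M" "{a, b} = {x, y}" "a \<noteq> b" for a b
    proof (intro exI conjI)
      have "a \<in> {x, y}" "b \<in> {x, y}" using that(2) by blast+
      then have ab: "a \<notin> A" "b \<notin> A" "a \<notin> B" "b \<notin> B" using nin by blast+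
      have "insert a A \<union> insert b B = {a, b} \<union> (A \<union> B)" by blast
      then have "insert a A \<union> insert b B = {x, y} \<union> (S - {x, y})" using AB(1) that(2) by simp
      then show "insert a A \<union> insert b B = S" using xy(1,2) by auto
      show "insert a A \<inter> insert b B = {}" using AB(2) that(3) ab by blast
      show "card (insert a A) \<le> Suc p" "card (insert b B) \<le> Suc p"
        using AB(3,4) ab fin by simp_all
      show "\<bar>sum w (insert a A) - sum w (insert b B)\<bar> \<le> M" using fin that(1) ab by simp
    qed
    have "0 \<le> w x" "w x \<le> M" "0 \<le> w y" "w y \<le> M" using Suc.prems(3) xy by auto
    then have "\<bar>(w x + sum w A) - (w y + sum w B)\<bar> \<le> M \<or> \<bar>(w y + sum w A) - (w x + sum w B)\<bar> \<le> M"
      using AB(5) by linarith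
    then show ?thesis using ins[of x y] ins[of y x] xy(3) by blast
  qed
qed

section \<open>Atomless measures and allocations in the limit\<close>

locale atomless_finite_measure = finite_measure M for M :: "real measure" +
  assumes sets_eq_lebesgue [measurable_cong, simp]: "sets M = sets lebesgue"
    and measure_singleton [simp]: "measure M {x} = 0"
begin

lemma borel_in_sets: "A \<in> sets borel \<Longrightarrow> A \<in> sets lebesgue"
  using sets_completionI_sets[of A lborel] by simp

lemma measure_finite_eq_0: "finite F \<Longrightarrow> measure M F = 0"
proof (induction F rule: finite_induct)
  case (insert x F)
  have "{x} \<in> sets M" "F \<in> sets M" using borel_in_sets insert by (auto simp: finite_imp_closed borel_closed)
  then have "measure M ({x} \<union> F) \<le> measure M {x} + measure M F" by (rule measure_Un_le)
  then show ?case using insert by (simp add: measure_le_0_iff)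
qed simp

text \<open>
  By dominated convergence: at a point that is not a limit of endpoints, membership in \<open>Z N\<close> is
  eventually constant. The sets \<open>Z N\<close> may contain any of their endpoints.
\<close>
lemma measure_tendsto_of_endpoints:
  fixes k :: nat
  assumes a: "\<And>l. l < k \<Longrightarrow> (\<lambda>N. a N l) \<longlonglongrightarrow> \<alpha> l" and b: "\<And>l. l < k \<Longrightarrow> (\<lambda>N. b N l) \<longlonglongrightarrow> \<beta> l"
    and meas: "\<And>N. Z N \<in> sets lebesgue"
    and inner: "\<And>N l. l < k \<Longrightarrow> {a N l<..<b N l} \<subseteq> Z N"
    and outer: "\<And>N. Z N \<subseteq> (\<Union>l<k. {a N l..b N l})"
  shows "(\<lambda>N. measure M (Z N)) \<longlonglongrightarrow> measure M (\<Union>l<k. {\<alpha> l<..<\<beta> l})"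
proof -
  define X where "X = (\<Union>l<k. {\<alpha> l<..<\<beta> l})"
  define E where "E = \<alpha> ` {..<k} \<union> \<beta> ` {..<k}"
  have X: "X \<in> sets M" unfolding X_def by (auto intro!: borel_in_sets borel_open open_UN)
  have E: "E \<in> null_sets M"
  proof
    have "finite E" by (simp add: E_def)
    then show "emeasure M E = 0" by (simp add: emeasure_eq_measure measure_finite_eq_0)
    show "E \<in> sets M" by (auto intro!: borel_in_sets borel_closed finite_imp_closed simp: E_def)
  qed
  have pointwise: "(\<lambda>N. indicat_real (Z N) x) \<longlonglongrightarrow> indicat_real X x" if "x \<notin> E" for x
  proof (rule tendsto_eventually, cases "x \<in> X")
    case True
    then obtain l where l: "l < k" "\<alpha> l < x" "x < \<beta> l" by (auto simp: X_def)
    show "\<forall>\<^sub>F N in sequentially. indicat_real (Z N) x = indicat_real X x"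
      using order_tendstoD(2)[OF a[OF l(1)] l(2)] order_tendstoD(1)[OF b[OF l(1)] l(3)]
    proof eventually_elim
      case (elim N)
      then have "x \<in> Z N" using inner[OF l(1), of N] by auto
      then show ?case using True by simp
    qed
  next
    case False
    have "\<forall>\<^sub>F N in sequentially. x \<notin> {a N l..b N l}" if l: "l < k" for l
    proof -
      have "x < \<alpha> l \<or> \<beta> l < x"
        using False \<open>x \<notin> E\<close> l by (force simp: X_def E_def not_less order_le_less)
      then show ?thesis
      proof
        assume "x < \<alpha> l"
        from order_tendstoD(1)[OF a[OF l] this] show ?thesis by eventually_elim auto
      next
        assume "\<beta> l < x"
        from order_tendstoD(2)[OF b[OF l] this] show ?thesis by eventually_elim auto
      qed
    qed
    then have "\<forall>\<^sub>F N in sequentially. \<forall>l\<in>{..<k}. x \<notin> {a N l..b N l}"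
      by (intro eventually_ball_finite) auto
    then show "\<forall>\<^sub>F N in sequentially. indicat_real (Z N) x = indicat_real X x"
    proof eventually_elim
      case (elim N)
      then have "x \<notin> Z N" using outer[of N] by blast
      then show ?case using False by simp
    qed
  qed
  have "(\<lambda>N. integral\<^sup>L M (indicat_real (Z N))) \<longlonglongrightarrow> integral\<^sup>L M (indicat_real X)"
  proof (rule integral_dominated_convergence[where w = "\<lambda>_. 1"])
    show "AE x in M. (\<lambda>N. indicat_real (Z N) x) \<longlonglongrightarrow> indicat_real X x"
      using AE_not_in[OF E] by eventually_elim (rule pointwise)
    show "indicat_real X \<in> borel_measurable M" using X by simp
    show "indicat_real (Z N) \<in> borel_measurable M" for N using meas by simp
  qed (auto simp: indicator_def)
  moreover have "integral\<^sup>L M (indicat_real A) = measure M A" if "A \<in> sets M" for A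
    using that by simp
  ultimately show ?thesis using X meas by (simp add: X_def)
qed

end

text \<open>
  All that matters about a value-measure is that intervals have a value that depends continuously on
  the endpoints, so it is replaced by a measure without atoms.
\<close>
lemma atomless_finite_measure_of_value_measure:
  assumes "value_measure C V" and C: "C \<in> sets lebesgue"
  shows "\<exists>M. atomless_finite_measure M \<and> (\<forall>Z\<in>sets lebesgue. Z \<subseteq> C \<longrightarrow> V Z = measure M Z)"
proof -
  obtain v where v: "\<And>x. x \<in> C \<Longrightarrow> 0 \<le> v x" "set_integrable lebesgue C v"
    "\<And>Z. Z \<in> sets lebesgue \<Longrightarrow> Z \<subseteq> C \<Longrightarrow> V Z = (LINT x:Z|lebesgue. v x)"
    using assms unfolding value_measure_def by blast
  define f where "f x = indicat_real C x * v x" for x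
  have f: "integrable lebesgue f" using v(2) by (simp add: set_integrable_def f_def[abs_def])
  have f0: "f x \<ge> 0" for x using v(1) by (auto simp: f_def indicator_def)
  define M where "M = density lebesgue (\<lambda>x. ennreal (f x))"
  have fm: "(\<lambda>x. ennreal (f x)) \<in> borel_measurable lebesgue" using f by auto
  have em: "emeasure M Z = (\<integral>\<^sup>+x\<in>Z. ennreal (f x) \<partial>lebesgue)" if "Z \<in> sets lebesgue" for Z
    unfolding M_def using fm that by (rule emeasure_density)
  have "atomless_finite_measure M"
  proof (intro atomless_finite_measure.intro atomless_finite_measure_axioms.intro finite_measureI)
    have "emeasure M (space M) = (\<integral>\<^sup>+x. ennreal (f x) \<partial>lebesgue)"
      using em[of UNIV] by (simp add: M_def)
    also have "\<dots> < \<infinity>" using f f0 by (simp add: integrable_iff_bounded)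
    finally show "emeasure M (space M) \<noteq> \<infinity>" by simp
    show "sets M = sets lebesgue" by (simp add: M_def)
    show "measure M {x} = 0" for x
    proof -
      have "{x} \<in> null_sets lebesgue" by (auto intro: null_sets_completionI)
      then have "emeasure M {x} = 0" using em[of "{x}"] nn_integral_null_set[of "{x}" lebesgue] by auto
      then show ?thesis by (simp add: measure_def)
    qed
  qed
  moreover have "V Z = measure M Z" if "Z \<in> sets lebesgue" "Z \<subseteq> C" for Z
  proof -
    have "V Z = integral\<^sup>L lebesgue (\<lambda>x. f x * indicator Z x)"
      unfolding v(3)[OF that] set_lebesgue_integral_def
      using that(2) by (intro Bochner_Integration.integral_cong) (auto simp: f_def indicator_def)
    also have "\<dots> = enn2real (\<integral>\<^sup>+x. ennreal (f x * indicator Z x) \<partial>lebesgue)"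
      using f f0 that by (intro integral_eq_nn_integral) auto
    also have "(\<integral>\<^sup>+x. ennreal (f x * indicator Z x) \<partial>lebesgue) = emeasure M Z"
      unfolding em[OF that(1)] by (intro nn_integral_cong) (auto simp: indicator_def)
    finally show ?thesis by (simp add: measure_def)
  qed
  ultimately show ?thesis by blast
qed

lemma bounded_interval_between:
  fixes J :: "real set"
  assumes "is_interval J" "J \<noteq> {}" "J \<subseteq> {p..q}"
  shows "\<exists>a b. a \<le> b \<and> p \<le> a \<and> b \<le> q \<and> {a<..<b} \<subseteq> J \<and> J \<subseteq> {a..b}"
proof (intro exI conjI)
  have bdd: "bdd_above J" "bdd_below J" using assms(3) by (auto intro: bdd_above_mono bdd_below_mono)
  show out: "J \<subseteq> {Inf J..Sup J}" using bdd by (auto intro: cInf_lower cSup_upper)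
  then show "Inf J \<le> Sup J" using assms(2) by auto
  show "p \<le> Inf J" "Sup J \<le> q" using assms(2,3) by (auto intro!: cInf_greatest cSup_least)
  show "{Inf J<..<Sup J} \<subseteq> J"
  proof
    fix x assume "x \<in> {Inf J<..<Sup J}"
    then obtain y z where "y \<in> J" "y < x" "z \<in> J" "x < z"
      using cInf_less_iff[OF assms(2) bdd(2)] less_cSup_iff[OF assms(2) bdd(1)] by auto
    then show "x \<in> J" using mem_is_interval_1_I[OF assms(1), of y z x] by simp
  qed
qed

lemma borel_between:
  assumes "{a<..<b} \<subseteq> J" "J \<subseteq> {a..b::real}"
  shows "J \<in> sets borel"
proof -
  have "J = {a<..<b} \<union> (J \<inter> {a, b})" using assms by force
  moreover have "J \<inter> {a, b} \<in> sets borel" by (intro borel_closed finite_imp_closed) auto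
  ultimately show ?thesis by (metis sets.Un borel_open open_greaterThanLessThan)
qed

lemma unit_interval_between:
  assumes I: "is_interval (I :: real set)" and e: "emeasure lborel I = 1"
  shows "\<exists>a. {a<..<a+1} \<subseteq> I \<and> I \<subseteq> {a..a+1}"
proof -
  have diam: "y - x \<le> 1" if "x \<in> I" "y \<in> I" for x y
  proof (rule ccontr)
    assume c: "\<not> y - x \<le> 1"
    have "{x..y} \<subseteq> I" using mem_is_interval_1_I[OF I that] by (simp add: subset_iff)
    moreover have "I \<in> sets lborel" using e emeasure_notin_sets[of I lborel] by (metis zero_neq_one)
    ultimately have "emeasure lborel {x..y} \<le> 1" using e by (metis emeasure_mono)
    then show False using c by (simp flip: ennreal_1)
  qed
  have "I \<noteq> {}" using e by auto
  then obtain z where "z \<in> I" by blast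
  then have "I \<subseteq> {z - 1..z + 1}" using diam by fastforce
  then obtain a b where ab: "a \<le> b" "{a<..<b} \<subseteq> I" "I \<subseteq> {a..b}"
    using bounded_interval_between[OF I \<open>I \<noteq> {}\<close>] by blast
  have Im: "I \<in> sets lborel" using borel_between[OF ab(2,3)] by simp
  have "emeasure lborel {a<..<b} \<le> 1" "1 \<le> emeasure lborel {a..b}"
    using e emeasure_mono[OF ab(2) Im] emeasure_mono[OF ab(3), of lborel] by auto
  then have "b = a + 1" using ab(1) by (simp flip: ennreal_1)
  then show ?thesis using ab by blast
qed

lemma multicake_bounded:
  assumes "multicake m \<I>"
  shows "\<exists>B. \<Union>\<I> \<subseteq> {-B..B}"
proof -
  have "bounded I" if "I \<in> \<I>" for I
  proof -
    have "is_interval I" "emeasure lborel I = 1" using assms that by (auto simp: multicake_def)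
    from unit_interval_between[OF this] obtain a where "I \<subseteq> {a..a+1}" by blast
    then show ?thesis by (rule bounded_subset[OF bounded_closed_interval])
  qed
  then have "bounded (\<Union>\<I>)" using assms by (intro bounded_Union) (auto simp: multicake_def)
  then obtain B where B: "\<forall>x\<in>\<Union>\<I>. \<bar>x\<bar> \<le> B" by (auto simp: bounded_real)
  have "x \<in> {-B..B}" if "x \<in> \<Union>\<I>" for x
    using bspec[OF B that] by (simp add: abs_le_iff)
  then show ?thesis by blast
qed

lemma multicake_sets_lebesgue:
  assumes "multicake m \<I>" "I \<in> \<I>"
  shows "I \<in> sets lebesgue"
proof -
  obtain a where "{a<..<a+1} \<subseteq> I \<and> I \<subseteq> {a..a+1}"
    using unit_interval_between[of I] assms by (auto simp: multicake_def)
  then show ?thesis using borel_between sets_completionI_sets[of I lborel] by auto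
qed

lemma feasible_piece_endpoints:
  assumes "finite \<J>" "card \<J> \<le> k" "\<And>J. J \<in> \<J> \<Longrightarrow> is_interval J \<and> (\<exists>I\<in>\<I>. J \<subseteq> I)"
    and B: "\<Union>\<I> \<subseteq> {-B..B}" and "B \<ge> 0" "\<I> \<noteq> {}"
  shows "\<exists>a b. (\<forall>l<k. \<bar>a l\<bar> \<le> B \<and> \<bar>b l\<bar> \<le> B \<and> {a l<..<b l} \<subseteq> \<Union>\<J> \<and> (\<exists>I\<in>\<I>. {a l<..<b l} \<subseteq> I)) \<and>
     \<Union>\<J> \<subseteq> (\<Union>l<k. {a l..b l :: real})"
proof -
  obtain h where h: "bij_betw h {0..<card \<J>} \<J>" using ex_bij_betw_nat_finite[OF assms(1)] by blast
  define J where "J l = (if l < card \<J> then h l else {})" for l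
  have J: "J l \<in> \<J> \<or> J l = {}" for l using h by (auto simp: J_def bij_betw_def)
  have "\<exists>a b. \<bar>a\<bar> \<le> B \<and> \<bar>b\<bar> \<le> B \<and> {a<..<b} \<subseteq> J l \<and> J l \<subseteq> {a..b}" for l
  proof (cases "J l = {}")
    case True
    then show ?thesis using \<open>B \<ge> 0\<close> by (intro exI[of _ 0]) auto
  next
    case False
    then have "J l \<in> \<J>" using J by blast
    then have "is_interval (J l)" "J l \<subseteq> {-B..B}" using assms(3) B by blast+
    from bounded_interval_between[OF this(1) False this(2)]
    obtain a b where "a \<le> b" "- B \<le> a" "b \<le> B" "{a<..<b} \<subseteq> J l" "J l \<subseteq> {a..b}" by blast
    then show ?thesis by (intro exI[of _ a] exI[of _ b]) auto
  qed
  then obtain a b where ab: "\<And>l. \<bar>a l\<bar> \<le> B \<and> \<bar>b l\<bar> \<le> B \<and> {a l<..<b l} \<subseteq> J l \<and> J l \<subseteq> {a l..b l}" by metis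
  have "{a l<..<b l} \<subseteq> \<Union>\<J> \<and> (\<exists>I\<in>\<I>. {a l<..<b l} \<subseteq> I)" for l
    using ab[of l] J[of l] assms(3)[of "J l"] \<open>\<I> \<noteq> {}\<close> by blast
  moreover have "\<Union>\<J> \<subseteq> (\<Union>l<k. {a l..b l})"
  proof
    fix x assume "x \<in> \<Union>\<J>"
    then obtain X where "X \<in> h ` {0..<card \<J>}" "x \<in> X" using h by (auto simp: bij_betw_def)
    then obtain l where "l < card \<J>" "x \<in> h l" by auto
    then have "l < k" "x \<in> {a l..b l}" using ab[of l] assms(2) by (auto simp: J_def)
    then show "x \<in> (\<Union>l<k. {a l..b l})" by blast
  qed
  ultimately show ?thesis using ab by blast
qed

lemma feasible_sets_lebesgue:
  assumes C: "multicake m \<I>" and Z: "feasible k n \<I> Z" and i: "i < n"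
  shows "Z i \<in> sets lebesgue"
proof -
  obtain \<J> where J: "finite \<J>" "\<And>J. J \<in> \<J> \<Longrightarrow> is_interval J \<and> (\<exists>I\<in>\<I>. J \<subseteq> I)" "Z i = \<Union>\<J>"
    using Z[unfolded feasible_def, rule_format, OF i] by (elim exE conjE) (rule that, auto)
  obtain B where B: "\<Union>\<I> \<subseteq> {-B..B}" using multicake_bounded[OF C] by blast
  have "J \<in> sets lebesgue" if "J \<in> \<J>" for J
  proof (cases "J = {}")
    case False
    have "is_interval J" "J \<subseteq> {-B..B}" using J(2)[OF that] B by blast+
    from bounded_interval_between[OF this(1) False this(2)]
    obtain a b where "{a<..<b} \<subseteq> J" "J \<subseteq> {a..b}" by blast
    then have "J \<in> sets borel" by (rule borel_between)
    then show ?thesis using sets_completionI_sets[of J lborel] by simp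
  qed simp
  then show ?thesis unfolding J(3) using J(1) by (intro sets.finite_Union) auto
qed

lemma multicake_Union_sets_lebesgue:
  assumes "multicake m \<I>"
  shows "\<Union>\<I> \<in> sets lebesgue"
  using assms multicake_sets_lebesgue[OF assms] by (intro sets.finite_Union) (auto simp: multicake_def)

text \<open>
  The compactness argument of the development. The endpoints of the pieces of allocations that meet all
  requirements up to \<open>\<delta>\<close> are bounded, so for \<open>\<delta> \<rightarrow> 0\<close> they converge along a subsequence. The limiting
  open intervals form an allocation: a point in one of them eventually lies in the corresponding interval of the
  sequence, hence in the right agent's share. Values converge, so the requirements hold exactly.
\<close>
lemma approximate_allocations_converge:
  assumes C: "multicake m \<I>" and "m > 0" and \<mu>: "\<And>i. i < n \<Longrightarrow> atomless_finite_measure (\<mu> i)"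
    and approx: "\<And>\<delta>. \<delta> > 0 \<Longrightarrow> \<exists>Z. allocation n (\<Union>\<I>) Z \<and> feasible k n \<I> Z \<and>
      (\<forall>i<n. (\<forall>j<n. measure (\<mu> i) (Z j) \<le> measure (\<mu> i) (Z i) + \<delta>) \<and> c i \<le> measure (\<mu> i) (Z i) + \<delta>)"
  shows "\<exists>Z. allocation n (\<Union>\<I>) Z \<and> feasible k n \<I> Z \<and>
      (\<forall>i<n. (\<forall>j<n. measure (\<mu> i) (Z j) \<le> measure (\<mu> i) (Z i)) \<and> c i \<le> measure (\<mu> i) (Z i))"
proof -
  define \<delta> where "\<delta> N = 1 / real (Suc N)" for N
  have "\<delta> N > 0" for N by (simp add: \<delta>_def)
  from approx[OF this] obtain Z where alloc: "\<And>N. allocation n (\<Union>\<I>) (Z N)" and feas: "\<And>N. feasible k n \<I> (Z N)"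
    and env: "\<And>N i j. i < n \<Longrightarrow> j < n \<Longrightarrow> measure (\<mu> i) (Z N j) \<le> measure (\<mu> i) (Z N i) + \<delta> N"
    and val: "\<And>N i. i < n \<Longrightarrow> c i \<le> measure (\<mu> i) (Z N i) + \<delta> N"
    by metis
  obtain B0 where B0: "\<Union>\<I> \<subseteq> {-B0..B0}" using multicake_bounded[OF C] by blast
  define B where "B = max 0 B0"
  have B: "\<Union>\<I> \<subseteq> {-B..B}" "B \<ge> 0" using B0 by (force simp: B_def)+
  have ne: "\<I> \<noteq> {}" using C \<open>m > 0\<close> by (auto simp: multicake_def)
  define E where "E N i a b \<longleftrightarrow> (\<forall>l<k. \<bar>a l\<bar> \<le> B \<and> \<bar>b l\<bar> \<le> B \<and> {a l<..<b l} \<subseteq> Z N i \<and> (\<exists>I\<in>\<I>. {a l<..<b l} \<subseteq> I)) \<and>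
     Z N i \<subseteq> (\<Union>l<k. {a l..b l :: real})" for N i a b
  have "\<exists>a b. E N i a b" if i: "i < n" for N i
  proof -
    obtain \<J> where J: "finite \<J>" "card \<J> \<le> k" "\<And>J. J \<in> \<J> \<Longrightarrow> is_interval J \<and> (\<exists>I\<in>\<I>. J \<subseteq> I)" "Z N i = \<Union>\<J>"
      using feas[of N, unfolded feasible_def, rule_format, OF i] by (elim exE conjE) (rule that, auto)
    show ?thesis unfolding E_def J(4) by (rule feasible_piece_endpoints[OF J(1-3) B ne])
  qed
  then have "\<forall>N i. \<exists>a b. i < n \<longrightarrow> E N i a b" by blast
  then obtain a b where ab: "\<And>N i. i < n \<Longrightarrow> E N i (a N i) (b N i)"
    unfolding choice_iff by blast
  \<comment> \<open>All endpoints form one family, to take a single subsequence.\<close>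
  define \<xi> where "\<xi> N = (\<lambda>(i, l, right). if right then b N i l else a N i l)" for N
  have "\<exists>\<rho> x. strict_mono (\<rho> :: nat \<Rightarrow> nat) \<and> (\<forall>p\<in>{..<n} \<times> {..<k} \<times> UNIV. (\<lambda>N. \<xi> (\<rho> N) p) \<longlonglongrightarrow> x p)"
    using ab by (intro convergent_coordinates[where B = B]) (auto simp: \<xi>_def E_def)
  then obtain \<rho> x where \<rho>: "strict_mono (\<rho> :: nat \<Rightarrow> nat)"
    and lim': "\<forall>p\<in>{..<n} \<times> {..<k} \<times> UNIV. (\<lambda>N. \<xi> (\<rho> N) p) \<longlonglongrightarrow> x p" by blast
  have lim: "(\<lambda>N. \<xi> (\<rho> N) (i, l, right)) \<longlonglongrightarrow> x (i, l, right)" if "i < n" "l < k" for i l right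
    using bspec[OF lim', of "(i, l, right)"] that by simp
  define \<alpha> where "\<alpha> i l = x (i, l, False)" for i l
  define \<beta> where "\<beta> i l = x (i, l, True)" for i l
  have a: "(\<lambda>N. a (\<rho> N) i l) \<longlonglongrightarrow> \<alpha> i l" and b: "(\<lambda>N. b (\<rho> N) i l) \<longlonglongrightarrow> \<beta> i l" if "i < n" "l < k" for i l
    using lim[OF that, of False] lim[OF that, of True] by (simp_all add: \<xi>_def \<alpha>_def \<beta>_def)
  define Y where "Y i = (\<Union>l<k. {\<alpha> i l<..<\<beta> i l})" for i
  have ev: "\<forall>\<^sub>F N in sequentially. y \<in> {a (\<rho> N) i l<..<b (\<rho> N) i l}"
    if il: "i < n" "l < k" and y: "y \<in> {\<alpha> i l<..<\<beta> i l}" for i l y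
  proof -
    have "\<alpha> i l < y" "y < \<beta> i l" using y by auto
    from order_tendstoD(2)[OF a[OF il] this(1)] order_tendstoD(1)[OF b[OF il] this(2)]
    show ?thesis by eventually_elim simp
  qed
  have evZ: "\<forall>\<^sub>F N in sequentially. y \<in> Z (\<rho> N) i" if i: "i < n" and y: "y \<in> Y i" for i y
  proof -
    obtain l where l: "l < k" "y \<in> {\<alpha> i l<..<\<beta> i l}" using y by (auto simp: Y_def)
    show ?thesis using ev[OF i l]
    proof eventually_elim
      case (elim N)
      then show ?case using ab[OF i, of "\<rho> N"] l(1) unfolding E_def by blast
    qed
  qed
  have YC: "Y i \<subseteq> \<Union>\<I>" if "i < n" for i
  proof
    fix y assume "y \<in> Y i"
    from eventually_happens'[OF sequentially_bot evZ[OF that this]]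
    obtain N where "y \<in> Z (\<rho> N) i" by blast
    then show "y \<in> \<Union>\<I>" using alloc[of "\<rho> N"] that unfolding allocation_def by blast
  qed
  have "allocation n (\<Union>\<I>) Y"
    unfolding allocation_def disjoint_family_on_def
  proof (intro conjI allI impI ballI YC)
    fix i j assume ij: "i \<in> {..<n}" "j \<in> {..<n}" "i \<noteq> j"
    show "Y i \<inter> Y j = {}"
    proof (rule ccontr)
      assume "Y i \<inter> Y j \<noteq> {}"
      then obtain y where y: "y \<in> Y i" "y \<in> Y j" by blast
      have "\<forall>\<^sub>F N in sequentially. y \<in> Z (\<rho> N) i \<and> y \<in> Z (\<rho> N) j"
        using evZ y ij by (auto intro: eventually_conj)
      from eventually_happens'[OF sequentially_bot this]
      obtain N where "y \<in> Z (\<rho> N) i" "y \<in> Z (\<rho> N) j" by blast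
      then show False using alloc[of "\<rho> N"] ij unfolding allocation_def disjoint_family_on_def by blast
    qed
  qed
  moreover have "feasible k n \<I> Y"
    unfolding feasible_def
  proof (intro allI impI)
    fix i assume i: "i < n"
    have "\<exists>I\<in>\<I>. {\<alpha> i l<..<\<beta> i l} \<subseteq> I" if l: "l < k" for l
    proof (cases "{\<alpha> i l<..<\<beta> i l} = {}")
      case True
      then show ?thesis using ne by blast
    next
      case False
      then obtain y where y: "y \<in> {\<alpha> i l<..<\<beta> i l}" by blast
      then have "y \<in> Y i" using l by (auto simp: Y_def)
      then obtain I where I: "I \<in> \<I>" "y \<in> I" using YC[OF i] by blast
      \<comment> \<open>Eventually \<open>y\<close> and \<open>z\<close> lie in a common interval of the sequence, which lies in a single
        island; by disjointness it is the island of \<open>y\<close>.\<close>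
      have "z \<in> I" if z: "z \<in> {\<alpha> i l<..<\<beta> i l}" for z
      proof -
        from eventually_happens'[OF sequentially_bot eventually_conj[OF ev[OF i l y] ev[OF i l z]]]
        obtain N where "y \<in> {a (\<rho> N) i l<..<b (\<rho> N) i l}" "z \<in> {a (\<rho> N) i l<..<b (\<rho> N) i l}" by blast
        moreover obtain I' where "I' \<in> \<I>" "{a (\<rho> N) i l<..<b (\<rho> N) i l} \<subseteq> I'"
          using ab[OF i, of "\<rho> N"] l unfolding E_def by blast
        ultimately have "I' \<in> \<I>" "y \<in> I'" "z \<in> I'" by blast+
        then show ?thesis using C I disjointD[of \<I> I I'] unfolding multicake_def by blast
      qed
      then show ?thesis using I by blast
    qed
    then show "\<exists>\<J>. finite \<J> \<and> card \<J> \<le> k \<and> (\<forall>J\<in>\<J>. is_interval J \<and> (\<exists>I\<in>\<I>. J \<subseteq> I)) \<and> Y i = \<Union>\<J>"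
      unfolding Y_def using card_image_le[of "{..<k}" "\<lambda>l. {\<alpha> i l<..<\<beta> i l}"]
      by (intro exI[of _ "(\<lambda>l. {\<alpha> i l<..<\<beta> i l}) ` {..<k}"]) (auto simp: is_interval_1)
  qed
  moreover have "(\<forall>j<n. measure (\<mu> i) (Y j) \<le> measure (\<mu> i) (Y i)) \<and> c i \<le> measure (\<mu> i) (Y i)" if i: "i < n" for i
  proof -
    have m: "(\<lambda>N. measure (\<mu> i) (Z (\<rho> N) j)) \<longlonglongrightarrow> measure (\<mu> i) (Y j)" if j: "j < n" for j
      unfolding Y_def
    proof (rule atomless_finite_measure.measure_tendsto_of_endpoints[OF \<mu>[OF i] a[OF j] b[OF j]])
      show "Z (\<rho> N) j \<in> sets lebesgue" for N by (rule feasible_sets_lebesgue[OF C feas j])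
      show "{a (\<rho> N) j l<..<b (\<rho> N) j l} \<subseteq> Z (\<rho> N) j" if "l < k" for N l
        using ab[OF j, of "\<rho> N"] that unfolding E_def by blast
      show "Z (\<rho> N) j \<subseteq> (\<Union>l<k. {a (\<rho> N) j l..b (\<rho> N) j l})" for N
        using ab[OF j, of "\<rho> N"] unfolding E_def by blast
    qed
    have "\<delta> \<longlonglongrightarrow> 0" unfolding \<delta>_def using LIMSEQ_inverse_real_of_nat by (simp add: inverse_eq_divide)
    from LIMSEQ_subseq_LIMSEQ[OF this \<rho>] have "(\<lambda>N. \<delta> (\<rho> N)) \<longlonglongrightarrow> 0" by (simp add: o_def)
    from tendsto_add[OF m[OF i] this]
    have m\<delta>: "(\<lambda>N. measure (\<mu> i) (Z (\<rho> N) i) + \<delta> (\<rho> N)) \<longlonglongrightarrow> measure (\<mu> i) (Y i)" by simp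
    show ?thesis
    proof (intro conjI allI impI)
      show "measure (\<mu> i) (Y j) \<le> measure (\<mu> i) (Y i)" if "j < n" for j
        using LIMSEQ_le[OF m[OF that] m\<delta>] env[OF i that] by blast
      show "c i \<le> measure (\<mu> i) (Y i)"
        using LIMSEQ_le_const[OF m\<delta>] val[OF i] by blast
    qed
  qed
  ultimately show ?thesis by blast
qed

text \<open>
  A guarantee can be verified up to any \<open>\<delta> > 0\<close>. The values \<open>V\<close> stay available next to
  the measures \<open>\<mu>\<close> that represent them because guarantees for smaller ratios speak of value-measures.
\<close>
lemma guaranteedI:
  assumes "m > 0"
    and approx: "\<And>\<I> V \<mu> \<delta>. multicake m \<I> \<Longrightarrow> \<forall>i<n. value_measure (\<Union>\<I>) (V i) \<Longrightarrow>
      (\<And>i. i < n \<Longrightarrow> atomless_finite_measure (\<mu> i)) \<Longrightarrow>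
      (\<And>i Z. i < n \<Longrightarrow> Z \<in> sets lebesgue \<Longrightarrow> Z \<subseteq> \<Union>\<I> \<Longrightarrow> V i Z = measure (\<mu> i) Z) \<Longrightarrow> \<delta> > 0 \<Longrightarrow>
      \<exists>Z. allocation n (\<Union>\<I>) Z \<and> feasible k n \<I> Z \<and>
        (\<forall>i<n. (\<forall>j<n. measure (\<mu> i) (Z j) \<le> measure (\<mu> i) (Z i) + \<delta>) \<and> r * measure (\<mu> i) (\<Union>\<I>) \<le> measure (\<mu> i) (Z i) + \<delta>)"
  shows "guaranteed m k n r"
  unfolding guaranteed_def
proof (intro allI impI, elim conjE)
  fix \<I> V assume C: "multicake m \<I>" and V: "\<forall>i<n. value_measure (\<Union>\<I>) (V i)"
  have CL: "\<Union>\<I> \<in> sets lebesgue" by (rule multicake_Union_sets_lebesgue[OF C])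
  have "\<forall>i<n. \<exists>M. atomless_finite_measure M \<and> (\<forall>Z\<in>sets lebesgue. Z \<subseteq> \<Union>\<I> \<longrightarrow> V i Z = measure M Z)"
    using atomless_finite_measure_of_value_measure[OF _ CL] V by blast
  then obtain \<mu> where \<mu>: "\<And>i. i < n \<Longrightarrow> atomless_finite_measure (\<mu> i)"
    and V\<mu>: "\<And>i Z. i < n \<Longrightarrow> Z \<in> sets lebesgue \<Longrightarrow> Z \<subseteq> \<Union>\<I> \<Longrightarrow> V i Z = measure (\<mu> i) Z" by metis
  have conv: "\<exists>Z. allocation n (\<Union>\<I>) Z \<and> feasible k n \<I> Z \<and>
      (\<forall>i<n. (\<forall>j<n. measure (\<mu> i) (Z j) \<le> measure (\<mu> i) (Z i)) \<and> r * measure (\<mu> i) (\<Union>\<I>) \<le> measure (\<mu> i) (Z i))"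
    using approx[OF C V, of \<mu>] \<mu> V\<mu>
    by (intro approximate_allocations_converge[OF C \<open>m > 0\<close>]) blast+
  obtain Z where Z: "allocation n (\<Union>\<I>) Z" "feasible k n \<I> Z"
    and env: "\<And>i j. i < n \<Longrightarrow> j < n \<Longrightarrow> measure (\<mu> i) (Z j) \<le> measure (\<mu> i) (Z i)"
    and val: "\<And>i. i < n \<Longrightarrow> r * measure (\<mu> i) (\<Union>\<I>) \<le> measure (\<mu> i) (Z i)"
    using conv by blast
  have "V i (Z j) = measure (\<mu> i) (Z j)" if "i < n" "j < n" for i j
    using V\<mu>[OF that(1) feasible_sets_lebesgue[OF C Z(2) that(2)]] Z(1) that(2) by (auto simp: allocation_def)
  then show "\<exists>Z. allocation n (\<Union>\<I>) Z \<and> feasible k n \<I> Z \<and> envy_free n V Z \<and> (\<forall>i<n. r * V i (\<Union>\<I>) \<le> V i (Z i))"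
    using Z env val V\<mu>[OF _ CL] by (intro exI[of _ Z]) (auto simp: envy_free_def)
qed

section \<open>From cuts of the concatenated cake to allocations\<close>

definition clamp01 :: "real \<Rightarrow> real" where
  "clamp01 u = max 0 (min 1 u)"

text \<open>
  The part of island \<open>l\<close> (with left endpoint \<open>a l\<close>) in the piece \<open>[s, t]\<close> of the concatenated
  cake, in which island \<open>l\<close> occupies \<open>[l, l + 1]\<close>. Open intervals lie in the island whichever endpoints
  it contains.
\<close>
definition segment :: "(nat \<Rightarrow> real) \<Rightarrow> nat \<Rightarrow> real \<Rightarrow> real \<Rightarrow> real set" where
  "segment a l s t = {a l + clamp01 (s - real l) <..< a l + clamp01 (t - real l)}"

lemma segment_outside: "l \<notin> met_unit_cells m s t \<Longrightarrow> l < m \<Longrightarrow> segment a l s t = {}"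
  by (auto simp: segment_def met_unit_cells_def clamp01_def)

lemma segment_same [simp]: "segment a l s s = {}"
  by (simp add: segment_def)

context atomless_finite_measure
begin

lemma measure_open_interval_split:
  assumes "a \<le> b" "b \<le> c"
  shows "measure M {a<..<c} = measure M {a<..<b} + measure M {b<..<c}"
proof (cases "a < b \<and> b < c")
  case True
  have "measure M {a<..<c} = measure M (({a<..<b} \<union> {b<..<c}) \<union> {b})"
    using True by (intro arg_cong[where f = "measure M"]) auto
  also have "\<dots> = measure M ({a<..<b} \<union> {b<..<c}) + measure M {b}"
    by (intro finite_measure_Union) (auto intro!: borel_in_sets)
  also have "\<dots> = measure M {a<..<b} + measure M {b<..<c}"
    by (subst finite_measure_Union) (auto intro!: borel_in_sets)
  finally show ?thesis .
next
  case False
  then have "a = b \<or> b = c" using assms by linarith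
  then show ?thesis by auto
qed

lemma measure_between_open_closed:
  assumes "{a<..<b} \<subseteq> I" "I \<subseteq> {a..b}"
  shows "measure M I = measure M {a<..<b}"
proof -
  have "I = {a<..<b} \<union> (I \<inter> {a, b})" using assms by force
  moreover have "I \<inter> {a, b} \<in> sets M" by (auto intro!: borel_in_sets borel_closed finite_imp_closed)
  moreover have "{a<..<b} \<in> sets M" by (auto intro!: borel_in_sets)
  moreover have "measure M ({a<..<b} \<union> (I \<inter> {a, b})) = measure M {a<..<b} + measure M (I \<inter> {a, b})"
    using calculation(2,3) by (intro finite_measure_Union) auto
  ultimately show ?thesis using measure_finite_eq_0[of "I \<inter> {a, b}"] by simp
qed

lemma measure_segment_split:
  assumes "s \<le> t" "t \<le> u"
  shows "measure M (segment a l s u) = measure M (segment a l s t) + measure M (segment a l t u)"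
  unfolding segment_def using assms by (intro measure_open_interval_split) (auto simp: clamp01_def)

lemma sum_measure_segment:
  assumes "\<And>j. j < n \<Longrightarrow> t j \<le> t (Suc j)"
  shows "(\<Sum>j<n. measure M (segment a l (t j) (t (Suc j)))) = measure M (segment a l (t 0) (t n))"
  using assms
proof (induction n)
  case (Suc n)
  have "t 0 \<le> t n" "t n \<le> t (Suc n)" using Suc.prems le_by_steps[of "Suc n" t 0 n] by auto
  then show ?case using Suc measure_segment_split[of "t 0" "t n" "t (Suc n)" a l] by simp
qed simp

lemma tendsto_measure_segment:
  assumes "x \<longlonglongrightarrow> s" "y \<longlonglongrightarrow> t"
  shows "(\<lambda>N. measure M (segment a l (x N) (y N))) \<longlonglongrightarrow> measure M (segment a l s t)"
proof -
  have "(\<lambda>N. measure M (segment a l (x N) (y N))) \<longlonglongrightarrow>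
      measure M (\<Union>j<1::nat. {a l + clamp01 (s - real l)<..<a l + clamp01 (t - real l)})"
  proof (rule measure_tendsto_of_endpoints)
    show "(\<lambda>N. a l + clamp01 (x N - real l)) \<longlonglongrightarrow> a l + clamp01 (s - real l)"
      "(\<lambda>N. a l + clamp01 (y N - real l)) \<longlonglongrightarrow> a l + clamp01 (t - real l)"
      unfolding clamp01_def using assms by (auto intro!: tendsto_intros)
  qed (auto simp: segment_def intro!: borel_in_sets)
  moreover have "(\<Union>j<1::nat. X) = X" for X :: "real set" by auto
  ultimately show ?thesis by (simp only: segment_def)
qed

text \<open>
  The value of the piece \<open>[s, t]\<close> to an agent who may keep only \<open>k\<close> of its segments.
\<close>
definition bundle_value :: "nat \<Rightarrow> nat \<Rightarrow> (nat \<Rightarrow> real) \<Rightarrow> real \<Rightarrow> real \<Rightarrow> real" where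
  "bundle_value m k a s t = Max ((\<lambda>L. \<Sum>l\<in>L. measure M (segment a l s t)) ` {L. L \<subseteq> {..<m} \<and> card L \<le> k})"

lemma finite_bundles [simp]: "finite {L :: nat set. L \<subseteq> {..<m} \<and> card L \<le> k}"
  by (rule finite_subset[of _ "Pow {..<m}"]) auto

lemma bundle_value_ge:
  assumes "L \<subseteq> {..<m}" "card L \<le> k"
  shows "(\<Sum>l\<in>L. measure M (segment a l s t)) \<le> bundle_value m k a s t"
  unfolding bundle_value_def using assms by (intro Max_ge) auto

lemma bundle_value_attained:
  "\<exists>L\<subseteq>{..<m}. card L \<le> k \<and> bundle_value m k a s t = (\<Sum>l\<in>L. measure M (segment a l s t))"
proof -
  have "{} \<in> {L :: nat set. L \<subseteq> {..<m} \<and> card L \<le> k}" by simp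
  then have "bundle_value m k a s t \<in> (\<lambda>L. \<Sum>l\<in>L. measure M (segment a l s t)) ` {L. L \<subseteq> {..<m} \<and> card L \<le> k}"
    unfolding bundle_value_def by (intro Max_in finite_imageI finite_bundles) blast
  then show ?thesis by auto
qed

lemma bundle_value_nonneg: "bundle_value m k a s t \<ge> 0"
  using bundle_value_ge[of "{}" m k a s t] by simp

lemma bundle_value_same: "bundle_value m k a s s = 0"
  using bundle_value_attained[of m k a s s] by auto

lemma tendsto_bundle_value:
  assumes "x \<longlonglongrightarrow> s" "y \<longlonglongrightarrow> t"
  shows "(\<lambda>N. bundle_value m k a (x N) (y N)) \<longlonglongrightarrow> bundle_value m k a s t"
proof -
  have "{} \<in> {L :: nat set. L \<subseteq> {..<m} \<and> card L \<le> k}" by simp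
  then show ?thesis
    unfolding bundle_value_def
    by (intro tendsto_Max_image tendsto_sum tendsto_measure_segment assms) (simp, blast)
qed

text \<open>
  Keeping the best \<open>k\<close> segments of a piece that meets \<open>c\<close> islands costs at most the factor
  \<open>max k c / k\<close>.
\<close>
lemma bundle_value_share:
  "real k * (\<Sum>l<m. measure M (segment a l s t)) \<le> real (max k (card (met_unit_cells m s t))) * bundle_value m k a s t"
proof -
  let ?w = "\<lambda>l. measure M (segment a l s t)" and ?S = "met_unit_cells m s t"
  obtain L where L: "L \<subseteq> ?S" "card L \<le> k" "real k * sum ?w ?S \<le> real (max k (card ?S)) * sum ?w L"
    using best_subset_share[of ?S ?w k] by auto
  have sub: "?S \<subseteq> {..<m}" by (auto simp: met_unit_cells_def)
  have "sum ?w {..<m} = sum ?w ?S"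
    using sub segment_outside[of _ m s t a] by (intro sum.mono_neutral_right) auto
  moreover have "sum ?w L \<le> bundle_value m k a s t" using L(1,2) sub by (intro bundle_value_ge) auto
  then have "real (max k (card ?S)) * sum ?w L \<le> real (max k (card ?S)) * bundle_value m k a s t"
    by (intro mult_left_mono) auto
  ultimately show ?thesis using L(3) by simp
qed

end

definition island_enumeration :: "nat \<Rightarrow> real set set \<Rightarrow> (nat \<Rightarrow> real set) \<Rightarrow> (nat \<Rightarrow> real) \<Rightarrow> bool" where
  "island_enumeration m \<I> e a \<longleftrightarrow> bij_betw e {..<m} \<I> \<and> (\<forall>l<m. {a l<..<a l + 1} \<subseteq> e l \<and> e l \<subseteq> {a l..a l + 1})"

lemma island_enumeration_exists:
  assumes "multicake m \<I>" "bij_betw e {..<m} \<I>"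
  shows "\<exists>a. island_enumeration m \<I> e a"
proof -
  have "\<forall>l. \<exists>a. l < m \<longrightarrow> {a<..<a + 1} \<subseteq> e l \<and> e l \<subseteq> {a..a + 1}"
  proof (intro allI)
    fix l
    show "\<exists>a. l < m \<longrightarrow> {a<..<a + 1} \<subseteq> e l \<and> e l \<subseteq> {a..a + 1}"
    proof (cases "l < m")
      case True
      then have "e l \<in> \<I>" using assms(2) by (auto simp: bij_betw_def)
      then have "is_interval (e l)" "emeasure lborel (e l) = 1" using assms(1) by (auto simp: multicake_def)
      from unit_interval_between[OF this] show ?thesis by blast
    qed simp
  qed
  then show ?thesis using assms(2) unfolding island_enumeration_def choice_iff by blast
qed

lemma segment_subset_island:
  assumes "island_enumeration m \<I> e a" "l < m"
  shows "segment a l s t \<subseteq> e l"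
proof -
  have "segment a l s t \<subseteq> {a l<..<a l + 1}" by (auto simp: segment_def clamp01_def)
  then show ?thesis using assms unfolding island_enumeration_def by blast
qed

lemma segments_disjoint:
  assumes C: "multicake m \<I>" and e: "island_enumeration m \<I> e a" and "l < m" "l' < m" "l \<noteq> l' \<or> t \<le> s'"
  shows "segment a l s t \<inter> segment a l' s' t' = {}"
proof (cases "l = l'")
  case True
  then have "clamp01 (t - real l) \<le> clamp01 (s' - real l)" using assms(5) by (auto simp: clamp01_def)
  then show ?thesis using True by (auto simp: segment_def)
next
  case False
  have "e l \<in> \<I>" "e l' \<in> \<I>" "e l \<noteq> e l'"
    using e False assms(3,4) by (auto simp: island_enumeration_def bij_betw_def inj_on_def)
  then have "e l \<inter> e l' = {}" using C by (auto simp: multicake_def dest: disjointD)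
  then show ?thesis using segment_subset_island[OF e assms(3), of s t] segment_subset_island[OF e assms(4), of s' t'] by blast
qed

lemma (in atomless_finite_measure) measure_full_segment:
  assumes e: "island_enumeration m \<I> e a" and "l < m" "s \<le> real l" "real l + 1 \<le> t"
  shows "measure M (segment a l s t) = measure M (e l)"
proof -
  have "segment a l s t = {a l<..<a l + 1}" using assms(3,4) by (auto simp: segment_def clamp01_def)
  then show ?thesis using measure_between_open_closed[of "a l" "a l + 1" "e l"] e \<open>l < m\<close>
    by (simp add: island_enumeration_def)
qed

lemma (in atomless_finite_measure) measure_multicake:
  assumes C: "multicake m \<I>" and e: "bij_betw e {..<m} \<I>"
  shows "measure M (\<Union>\<I>) = (\<Sum>l<m. measure M (e l))"
proof -
  have "\<Union>\<I> = (\<Union>l\<in>{..<m}. e l)" using e by (auto simp: bij_betw_def)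
  moreover have "e l \<in> \<I>" if "l < m" for l using e that by (auto simp: bij_betw_def)
  moreover have "disjoint_family_on e {..<m}"
    unfolding disjoint_family_on_def
  proof (intro ballI impI)
    fix l l' assume "l \<in> {..<m}" "l' \<in> {..<m}" "l \<noteq> l'"
    then have "e l \<in> \<I>" "e l' \<in> \<I>" "e l \<noteq> e l'" using e by (auto simp: bij_betw_def inj_on_def)
    then show "e l \<inter> e l' = {}" using C by (auto simp: multicake_def dest: disjointD)
  qed
  ultimately show ?thesis
    using multicake_sets_lebesgue[OF C] by (simp add: finite_measure_finite_Union image_subset_iff)
qed

text \<open>
  Each agent gets the best \<open>k\<close> segments of its piece. What another agent keeps of piece \<open>j\<close> is worth no
  more than the best \<open>k\<close> segments of piece \<open>j\<close>, so envy-freeness for bundle values is inherited. Summing the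
  bounds on the loss over all pieces, \<open>k\<close> times the value of the cake is at most \<open>D\<close> times the value of a
  best bundle.
\<close>
lemma allocation_of_cut:
  assumes C: "multicake m \<I>" and e: "island_enumeration m \<I> e a" and "m > 0"
    and \<mu>: "\<And>i. i < n \<Longrightarrow> atomless_finite_measure (\<mu> i)"
    and t: "t 0 = 0" "t n = real m" "\<And>j. j < n \<Longrightarrow> t j \<le> t (Suc j)" and \<pi>: "bij_betw \<pi> {..<n} {..<n}"
    and env: "\<And>i j. i < n \<Longrightarrow> j < n \<Longrightarrow> atomless_finite_measure.bundle_value (\<mu> i) m k a (t j) (t (Suc j))
       \<le> atomless_finite_measure.bundle_value (\<mu> i) m k a (t (\<pi> i)) (t (Suc (\<pi> i))) + \<delta>"
    and D: "(\<Sum>j<n. max k (card (met_unit_cells m (t j) (t (Suc j))))) \<le> D" "D > 0" and "\<delta> \<ge> 0"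
  shows "\<exists>Z. allocation n (\<Union>\<I>) Z \<and> feasible k n \<I> Z \<and>
     (\<forall>i<n. (\<forall>j<n. measure (\<mu> i) (Z j) \<le> measure (\<mu> i) (Z i) + \<delta>) \<and>
        real k / real D * measure (\<mu> i) (\<Union>\<I>) \<le> measure (\<mu> i) (Z i) + \<delta>)"
proof -
  let ?U = "\<lambda>i j. atomless_finite_measure.bundle_value (\<mu> i) m k a (t j) (t (Suc j))"
  let ?seg = "\<lambda>l j. segment a l (t j) (t (Suc j))"
  have "\<forall>i. \<exists>L. i < n \<longrightarrow> L \<subseteq> {..<m} \<and> card L \<le> k \<and> ?U i (\<pi> i) = (\<Sum>l\<in>L. measure (\<mu> i) (?seg l (\<pi> i)))"
  proof
    fix i
    show "\<exists>L. i < n \<longrightarrow> L \<subseteq> {..<m} \<and> card L \<le> k \<and> ?U i (\<pi> i) = (\<Sum>l\<in>L. measure (\<mu> i) (?seg l (\<pi> i)))"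
    proof (cases "i < n")
      case True
      from atomless_finite_measure.bundle_value_attained[OF \<mu>[OF True], where m = m and k = k and a = a and s = "t (\<pi> i)" and t = "t (Suc (\<pi> i))"]
      show ?thesis by (elim exE) (rule exI, blast)
    qed simp
  qed
  then obtain L where L: "\<And>i. i < n \<Longrightarrow> L i \<subseteq> {..<m} \<and> card (L i) \<le> k \<and> ?U i (\<pi> i) = (\<Sum>l\<in>L i. measure (\<mu> i) (?seg l (\<pi> i)))"
    unfolding choice_iff by blast
  define Z where "Z i = (\<Union>l\<in>L i. ?seg l (\<pi> i))" for i
  have \<pi>n: "\<pi> i < n" if "i < n" for i using \<pi> that by (auto simp: bij_betw_def)
  have tle: "t i \<le> t j" if "i \<le> j" "j \<le> n" for i j
    using le_by_steps[of n t i j] t(3) that by blast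
  have seg_disj: "?seg l j \<inter> ?seg l' j' = {}" if "l < m" "l' < m" "l \<noteq> l' \<or> j < j'" "j < n" "j' < n" for l l' j j'
    using that tle[of "Suc j" j'] by (intro segments_disjoint[OF C e]) auto
  have ZC: "Z i \<subseteq> \<Union>\<I>" if "i < n" for i
  proof -
    have "?seg l (\<pi> i) \<subseteq> \<Union>\<I>" if l: "l \<in> L i" for l
    proof -
      have "l < m" using L[OF \<open>i < n\<close>] l by auto
      moreover have "e l \<in> \<I>" using e \<open>l < m\<close> by (auto simp: island_enumeration_def bij_betw_def)
      ultimately show ?thesis using segment_subset_island[OF e] by blast
    qed
    then show ?thesis by (auto simp: Z_def)
  qed
  have "allocation n (\<Union>\<I>) Z"
    unfolding allocation_def disjoint_family_on_def
  proof (intro conjI allI impI ballI ZC)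
    fix i j assume ij: "i \<in> {..<n}" "j \<in> {..<n}" "i \<noteq> j"
    have ne: "\<pi> i \<noteq> \<pi> j" using \<pi> ij by (auto simp: bij_betw_def inj_on_def)
    have "?seg l (\<pi> i) \<inter> ?seg l' (\<pi> j) = {}" if "l \<in> L i" "l' \<in> L j" for l l'
    proof -
      have lm: "l < m" "l' < m" "\<pi> i < n" "\<pi> j < n" using L[of i] L[of j] ij that \<pi>n by auto
      consider "\<pi> i < \<pi> j" | "\<pi> j < \<pi> i" using ne by linarith
      then show ?thesis
      proof cases
        case 1
        then show ?thesis using seg_disj[OF lm(1,2) _ lm(3,4)] by blast
      next
        case 2
        then show ?thesis using seg_disj[OF lm(2,1) _ lm(4,3)] by blast
      qed
    qed
    then show "Z i \<inter> Z j = {}" unfolding Z_def by blast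
  qed
  moreover have "feasible k n \<I> Z"
    unfolding feasible_def
  proof (intro allI impI)
    fix i assume i: "i < n"
    have fin: "finite (L i)" using L[OF i] finite_subset by blast
    have "\<exists>I\<in>\<I>. ?seg l (\<pi> i) \<subseteq> I" if "l \<in> L i" for l
    proof -
      have "l < m" using L[OF i] that by auto
      moreover have "e l \<in> \<I>" using e \<open>l < m\<close> by (auto simp: island_enumeration_def bij_betw_def)
      ultimately show ?thesis using segment_subset_island[OF e] by blast
    qed
    moreover have "is_interval (?seg l (\<pi> i))" for l by (auto simp: segment_def is_interval_1)
    moreover have "card ((\<lambda>l. ?seg l (\<pi> i)) ` L i) \<le> k" using card_image_le[OF fin] L[OF i] le_trans by blast
    ultimately show "\<exists>\<J>. finite \<J> \<and> card \<J> \<le> k \<and> (\<forall>J\<in>\<J>. is_interval J \<and> (\<exists>I\<in>\<I>. J \<subseteq> I)) \<and> Z i = \<Union>\<J>"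
      using fin by (intro exI[of _ "(\<lambda>l. ?seg l (\<pi> i)) ` L i"]) (simp add: Z_def)
  qed
  moreover have "(\<forall>j<n. measure (\<mu> i) (Z j) \<le> measure (\<mu> i) (Z i) + \<delta>) \<and>
        real k / real D * measure (\<mu> i) (\<Union>\<I>) \<le> measure (\<mu> i) (Z i) + \<delta>" if i: "i < n" for i
  proof -
    interpret atomless_finite_measure "\<mu> i" by (rule \<mu>[OF i])
    have mZ: "measure (\<mu> i) (Z j) = (\<Sum>l\<in>L j. measure (\<mu> i) (?seg l (\<pi> j)))" if j: "j < n" for j
      unfolding Z_def
    proof (rule finite_measure_finite_Union)
      show "finite (L j)" using L[OF j] finite_subset by blast
      show "(\<lambda>l. ?seg l (\<pi> j)) ` L j \<subseteq> sets (\<mu> i)" by (auto simp: segment_def intro!: borel_in_sets)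
      show "disjoint_family_on (\<lambda>l. ?seg l (\<pi> j)) (L j)"
        unfolding disjoint_family_on_def
      proof (intro ballI impI)
        fix l l' assume "l \<in> L j" "l' \<in> L j" "l \<noteq> l'"
        moreover have "l < m" "l' < m" using L[OF j] calculation by auto
        ultimately show "?seg l (\<pi> j) \<inter> ?seg l' (\<pi> j) = {}" using \<pi>n[OF j] by (intro seg_disj) auto
      qed
    qed
    have mZi: "measure (\<mu> i) (Z i) = ?U i (\<pi> i)" using mZ[OF i] L[OF i] by simp
    have best: "?U i j \<le> measure (\<mu> i) (Z i) + \<delta>" if "j < n" for j
      unfolding mZi by (rule env[OF i that])
    have "measure (\<mu> i) (Z j) \<le> measure (\<mu> i) (Z i) + \<delta>" if j: "j < n" for j
    proof -
      have "measure (\<mu> i) (Z j) \<le> ?U i (\<pi> j)"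
        unfolding mZ[OF j] using L[OF j] by (intro bundle_value_ge) auto
      then show ?thesis using best[OF \<pi>n[OF j]] by linarith
    qed
    moreover have "real k / real D * measure (\<mu> i) (\<Union>\<I>) \<le> measure (\<mu> i) (Z i) + \<delta>"
    proof -
      have "measure (\<mu> i) (\<Union>\<I>) = (\<Sum>l<m. measure (\<mu> i) (e l))"
        using e by (intro measure_multicake[OF C]) (simp add: island_enumeration_def)
      also have "\<dots> = (\<Sum>l<m. measure (\<mu> i) (segment a l (t 0) (t n)))"
        using t by (intro sum.cong refl measure_full_segment[OF e, symmetric]) auto
      also have "\<dots> = (\<Sum>l<m. \<Sum>j<n. measure (\<mu> i) (?seg l j))"
        using t(3) by (simp add: sum_measure_segment)
      also have "\<dots> = (\<Sum>j<n. \<Sum>l<m. measure (\<mu> i) (?seg l j))" by (rule sum.swap)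
      finally have "real k * measure (\<mu> i) (\<Union>\<I>) = (\<Sum>j<n. real k * (\<Sum>l<m. measure (\<mu> i) (?seg l j)))"
        by (simp add: sum_distrib_left)
      also have "\<dots> \<le> (\<Sum>j<n. real (max k (card (met_unit_cells m (t j) (t (Suc j))))) * (measure (\<mu> i) (Z i) + \<delta>))"
      proof (rule sum_mono)
        fix j assume "j \<in> {..<n}"
        then show "real k * (\<Sum>l<m. measure (\<mu> i) (?seg l j)) \<le> real (max k (card (met_unit_cells m (t j) (t (Suc j))))) * (measure (\<mu> i) (Z i) + \<delta>)"
          using best[of j] by (intro order_trans[OF bundle_value_share mult_left_mono]) auto
      qed
      also have "\<dots> = real (\<Sum>j<n. max k (card (met_unit_cells m (t j) (t (Suc j))))) * (measure (\<mu> i) (Z i) + \<delta>)"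
        by (simp add: sum_distrib_right)
      also have "\<dots> \<le> real D * (measure (\<mu> i) (Z i) + \<delta>)"
        using D(1) \<open>\<delta> \<ge> 0\<close> by (intro mult_right_mono) (auto simp flip: of_nat_sum)
      finally show ?thesis using D(2) by (simp add: field_simps)
    qed
    ultimately show ?thesis by blast
  qed
  ultimately show ?thesis by blast
qed

section \<open>Lower bounds\<close>

lemma guaranteed_general:
  assumes "m > 0" "k > 0" "n > 0"
  shows "guaranteed m k n (real k / real (max (n * k) (m + (n - 1) * k)))"
proof (rule guaranteedI[OF \<open>m > 0\<close>])
  fix \<I> V \<mu> and \<delta> :: real
  assume C: "multicake m \<I>" and \<mu>: "\<And>i. i < n \<Longrightarrow> atomless_finite_measure (\<mu> i)" and "\<delta> > 0"
  obtain e where "bij_betw e {..<m} \<I>"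
    using C ex_bij_betw_nat_finite[of \<I>] by (auto simp: multicake_def atLeast0LessThan)
  then obtain a where e: "island_enumeration m \<I> e a" using island_enumeration_exists[OF C] by blast
  obtain t \<pi> where t: "t 0 = 0" "t n = real m" "\<forall>j<n. t j \<le> t (Suc j)" "bij_betw \<pi> {..<n} {..<n}"
    "\<forall>i<n. \<forall>j<n. atomless_finite_measure.bundle_value (\<mu> i) m k a (t j) (t (Suc j))
       \<le> atomless_finite_measure.bundle_value (\<mu> i) m k a (t (\<pi> i)) (t (Suc (\<pi> i))) + \<delta>"
    using approx_envy_free_cut[of n "real m" \<delta> "\<lambda>i. atomless_finite_measure.bundle_value (\<mu> i) m k a"]
      \<open>n > 0\<close> \<open>\<delta> > 0\<close> atomless_finite_measure.tendsto_bundle_value[OF \<mu>]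
      atomless_finite_measure.bundle_value_nonneg[OF \<mu>] atomless_finite_measure.bundle_value_same[OF \<mu>] by auto
  have "(\<Sum>j<n. max k (card (met_unit_cells m (t j) (t (Suc j))))) \<le> max (n * k) (m + (n - 1) * k)"
    using t(3) assms by (intro sum_max_card_met_unit_cells) auto
  then show "\<exists>Z. allocation n (\<Union>\<I>) Z \<and> feasible k n \<I> Z \<and>
        (\<forall>i<n. (\<forall>j<n. measure (\<mu> i) (Z j) \<le> measure (\<mu> i) (Z i) + \<delta>) \<and>
           real k / real (max (n * k) (m + (n - 1) * k)) * measure (\<mu> i) (\<Union>\<I>) \<le> measure (\<mu> i) (Z i) + \<delta>)"
    using t \<open>m > 0\<close> \<open>\<delta> > 0\<close> by (intro allocation_of_cut[OF C e \<open>m > 0\<close> \<mu>]) auto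
qed

text \<open>
  For two agents, agent \<open>0\<close> cuts and agent \<open>1\<close> chooses. The freedom to order the islands makes up for
  the loss when one piece meets fewer than \<open>k\<close> islands: the cut has to leave \<open>k - 1\<close> whole islands
  on either side, or at most \<open>k - 1\<close> if there are not enough. To this end up to \<open>2 (k - 1)\<close> islands other than a most valuable island \<open>R\<close> are
  divided into two groups whose values differ by at most that of \<open>R\<close>. One group comes first, the other one
  comes last, and the remaining islands lie between them. Together with \<open>R\<close> either group has at most
  \<open>k\<close> islands and is worth at least as much as the other one, so by the intermediate value theorem agent \<open>0\<close> is indifferent
  at a cut somewhere between the groups.
\<close>
lemma guaranteed_two:
  assumes "m > 0" "k > 0"
  shows "guaranteed m k 2 (real k / real (max (2 * k) (m + 1)))"
proof (rule guaranteedI[OF \<open>m > 0\<close>])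
  fix \<I> V and \<mu> :: "nat \<Rightarrow> real measure" and \<delta> :: real
  assume C: "multicake m \<I>" and \<mu>: "\<And>i. i < 2 \<Longrightarrow> atomless_finite_measure (\<mu> i)" and "\<delta> > 0"
  interpret atomless_finite_measure "\<mu> 0" using \<mu>[of 0] by simp
  have fin: "finite \<I>" "card \<I> = m" using C by (auto simp: multicake_def)
  define w where "w I = measure (\<mu> 0) I" for I
  have "w ` \<I> \<noteq> {}" using fin \<open>m > 0\<close> by auto
  then have "Max (w ` \<I>) \<in> w ` \<I>" using fin by (intro Max_in) auto
  then obtain R where "R \<in> \<I>" "w R = Max (w ` \<I>)" by auto
  then have R: "R \<in> \<I>" "\<And>I. I \<in> \<I> \<Longrightarrow> w I \<le> w R" using fin by auto
  have cR: "card (\<I> - {R}) = m - 1" using R fin by simp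
  obtain S where S: "S \<subseteq> \<I> - {R}" "card S = min (m - 1) (2 * (k - 1))"
    by (rule obtain_subset_with_card_n[of "min (m - 1) (2 * (k - 1))" "\<I> - {R}"]) (simp add: cR)
  have finS: "finite S" using S fin finite_subset by blast
  obtain A B where AB: "A \<union> B = S" "A \<inter> B = {}" "card A \<le> k - 1" "card B \<le> k - 1" and bal: "\<bar>sum w A - sum w B\<bar> \<le> w R"
    using balanced_bipartition[of S "k - 1" w "w R"] finS S R by (auto simp: w_def)
  define p q where "p = card A" and "q = card B"
  have finAB: "finite A" "finite B" using AB(1) finS by auto
  have pq: "p + q = min (m - 1) (2 * (k - 1))" "p < k" "q < k"
    using card_Un_disjoint[OF finAB AB(2)] AB S \<open>k > 0\<close> by (auto simp: p_def q_def)
  have "p + q < m" using pq \<open>m > 0\<close> by linarith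
  obtain xs ys zs where lists: "set xs = A" "distinct xs" "set ys = \<I> - S" "distinct ys" "set zs = B" "distinct zs"
    using finite_distinct_list finAB fin by (metis finite_Diff)
  define es where "es = xs @ ys @ zs"
  have es: "distinct es" "set es = \<I>" using lists AB S by (auto simp: es_def)
  have len: "length es = m" "length xs = p" "length zs = q"
    using es lists distinct_card fin by (metis p_def q_def)+
  have leny: "length ys = m - (p + q)" using len by (simp add: es_def)
  have "bij_betw (\<lambda>l. es ! l) {..<m} \<I>" using es len by (intro bij_betw_nth) auto
  then obtain a where e: "island_enumeration m \<I> (\<lambda>l. es ! l) a" using island_enumeration_exists[OF C] by blast
  have sumA: "(\<Sum>l<p. w (es ! l)) = sum w A"
  proof -
    have "bij_betw (\<lambda>l. xs ! l) {..<p} A" using lists len by (intro bij_betw_nth) auto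
    from sum.reindex_bij_betw[OF this, of w] show ?thesis using len by (simp add: es_def nth_append)
  qed
  have sumB: "(\<Sum>l\<in>{m - q..<m}. w (es ! l)) = sum w B"
  proof -
    have "bij_betw (\<lambda>l. zs ! l) {..<q} B" using lists len by (intro bij_betw_nth) auto
    then have "sum w B = (\<Sum>l<q. w (zs ! l))" using sum.reindex_bij_betw[of "\<lambda>l. zs ! l" "{..<q}" B w] by simp
    also have "\<dots> = (\<Sum>l<q. w (es ! (l + (m - q))))" using len leny by (intro sum.cong) (auto simp: es_def nth_append)
    also have "\<dots> = (\<Sum>l\<in>{m - q..<m}. w (es ! l))"
      using sum.shift_bounds_nat_ivl[of "\<lambda>l. w (es ! l)" 0 "m - q" q] \<open>p + q < m\<close>
      by (simp add: atLeast0LessThan)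
    finally show ?thesis by simp
  qed
  obtain r where r: "p \<le> r" "r < m - q" "es ! r = R"
  proof -
    have "R \<in> set ys" using R S lists by auto
    then obtain j where "j < length ys" "ys ! j = R" by (auto simp: in_set_conv_nth)
    then show thesis using len leny \<open>p + q < m\<close> by (intro that[of "p + j"]) (auto simp: es_def nth_append)
  qed
  define U where "U i s t = atomless_finite_measure.bundle_value (\<mu> i) m k a s t" for i s t
  have full: "measure (\<mu> 0) (segment a l s t) = w (es ! l)" if "l < m" "s \<le> real l" "real l + 1 \<le> t" for l s t
    unfolding w_def using measure_full_segment[OF e that] .
  \<comment> \<open>A piece that consists of the whole cells in \<open>X\<close> is worth at most their total value.\<close>
  have small: "U 0 s t \<le> (\<Sum>l\<in>X. w (es ! l))"
    if "X \<subseteq> {..<m}" "\<And>l. l \<in> X \<Longrightarrow> s \<le> real l \<and> real l + 1 \<le> t" "met_unit_cells m s t \<subseteq> X" for X s t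
  proof -
    obtain L where L: "L \<subseteq> {..<m}" "U 0 s t = (\<Sum>l\<in>L. measure (\<mu> 0) (segment a l s t))"
      using bundle_value_attained[of m k a s t] by (auto simp: U_def)
    have "U 0 s t \<le> (\<Sum>l<m. measure (\<mu> 0) (segment a l s t))"
      unfolding L(2) using L(1) by (intro sum_mono2) auto
    also have "\<dots> = (\<Sum>l\<in>X. measure (\<mu> 0) (segment a l s t))"
    proof (intro sum.mono_neutral_right ballI)
      fix l assume "l \<in> {..<m} - X"
      then have "segment a l s t = {}" using that(3) by (intro segment_outside[of l m]) auto
      then show "measure (\<mu> 0) (segment a l s t) = 0" by simp
    qed (use that(1) in auto)
    also have "\<dots> = (\<Sum>l\<in>X. w (es ! l))" using that by (intro sum.cong full) auto
    finally show ?thesis .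
  qed
  \<comment> \<open>A piece is worth at least as much as any \<open>k\<close> whole cells in it.\<close>
  have large: "(\<Sum>l\<in>X. w (es ! l)) \<le> U 0 s t"
    if "X \<subseteq> {..<m}" "card X \<le> k" "\<And>l. l \<in> X \<Longrightarrow> s \<le> real l \<and> real l + 1 \<le> t" for X s t
  proof -
    have "(\<Sum>l\<in>X. w (es ! l)) = (\<Sum>l\<in>X. measure (\<mu> 0) (segment a l s t))" using that by (intro sum.cong full[symmetric]) auto
    then show ?thesis unfolding U_def using bundle_value_ge[OF that(1,2)] by simp
  qed
  define d where "d s = U 0 0 s - U 0 s (real m)" for s
  have "d (real p) \<le> 0"
  proof -
    have "U 0 0 (real p) \<le> (\<Sum>l<p. w (es ! l))"
      using \<open>p + q < m\<close> by (intro small) (auto simp: met_unit_cells_def)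
    moreover have "(\<Sum>l\<in>insert r {m - q..<m}. w (es ! l)) \<le> U 0 (real p) (real m)"
      using r pq \<open>p + q < m\<close> by (intro large) (auto simp: card_insert_if)
    ultimately show ?thesis using r bal sumA sumB by (simp add: d_def)
  qed
  moreover have "0 \<le> d (real (m - q))"
  proof -
    have "U 0 (real (m - q)) (real m) \<le> (\<Sum>l\<in>{m - q..<m}. w (es ! l))"
      by (intro small) (auto simp: met_unit_cells_def)
    moreover have "(\<Sum>l\<in>insert r {..<p}. w (es ! l)) \<le> U 0 0 (real (m - q))"
      using r pq \<open>p + q < m\<close> by (intro large) (auto simp: card_insert_if)
    ultimately show ?thesis using r bal sumA sumB by (simp add: d_def)
  qed
  moreover have "isCont d s" for s
    unfolding d_def U_def continuous_at_sequentially o_def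
    by (auto intro!: tendsto_diff tendsto_bundle_value)
  ultimately obtain s where s: "real p \<le> s" "s \<le> real (m - q)" "d s = 0"
    using IVT[of d "real p" 0 "real (m - q)"] \<open>p + q < m\<close> by auto
  define t :: "nat \<Rightarrow> real" where "t = (\<lambda>j. if j = 0 then 0 else if j = 1 then s else real m)"
  have t: "t 0 = 0" "t 1 = s" "t (Suc 0) = s" "t (Suc 1) = real m" "t 2 = real m" by (auto simp: t_def)
  \<comment> \<open>The index of the piece that agent 1 chooses.\<close>
  define b :: nat where "b = (if U 1 0 s \<le> U 1 s (real m) then 1 else 0)"
  define \<pi> where "\<pi> i = (if i = (1::nat) then b else 1 - b)" for i
  have two: "{..<2::nat} = {0, 1}" by auto
  have \<pi>: "bij_betw \<pi> {..<2} {..<2}" unfolding two by (auto simp: bij_betw_def inj_on_def \<pi>_def b_def)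
  have eq: "U 0 0 s = U 0 s (real m)" using s(3) by (simp add: d_def)
  have env: "U i (t j) (t (Suc j)) \<le> U i (t (\<pi> i)) (t (Suc (\<pi> i))) + \<delta>" if "i < 2" "j < 2" for i j
  proof -
    have "i = 0 \<or> i = 1" "j = 0 \<or> j = 1" using that by auto
    then show ?thesis using eq \<open>\<delta> > 0\<close> by (auto simp: \<pi>_def b_def t numeral_2_eq_2[symmetric])
  qed
  have D: "(\<Sum>j<2. max k (card (met_unit_cells m (t j) (t (Suc j))))) \<le> max (2 * k) (m + 1)"
  proof -
    \<comment> \<open>The first piece meets at most \<open>c\<close> islands and the second one at most \<open>m + 1 - c\<close>. The maximum
      matters only for a cut right after the first group, where \<open>s = p\<close>.\<close>
    define c where "c = max (p + 1) (nat \<lceil>s\<rceil>)"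
    have "nat \<lceil>s\<rceil> \<le> m - q" using s(2) by linarith
    then have "nat \<lceil>s\<rceil> + q \<le> m" using \<open>p + q < m\<close> by linarith
    then have c: "p + 1 \<le> c" "c + q \<le> m" using \<open>p + q < m\<close> unfolding c_def by linarith+
    have "met_unit_cells m 0 s \<subseteq> {..<c}"
    proof
      fix l assume "l \<in> met_unit_cells m 0 s"
      then have "real l < s" by (simp add: met_unit_cells_def)
      then have "l < nat \<lceil>s\<rceil>" by linarith
      then show "l \<in> {..<c}" by (simp add: c_def)
    qed
    then have m1: "card (met_unit_cells m 0 s) \<le> c" using card_mono[of "{..<c}"] by simp
    have "met_unit_cells m s (real m) \<subseteq> {c - 1..<m}"
    proof
      fix l assume "l \<in> met_unit_cells m s (real m)"
      then have l: "l < m" "s < real l + 1" by (simp_all add: met_unit_cells_def)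
      then have "nat \<lceil>s\<rceil> \<le> l + 1" "p \<le> l" using s(1) by linarith+
      then have "c - 1 \<le> l" unfolding c_def by linarith
      then show "l \<in> {c - 1..<m}" using l by simp
    qed
    then have "card (met_unit_cells m s (real m)) \<le> card {c - 1..<m}" by (intro card_mono) auto
    then have m2: "card (met_unit_cells m s (real m)) \<le> m + 1 - c" using c by simp
    have "max k c + max k (m + 1 - c) \<le> max (2 * k) (m + 1)"
    proof (cases "m - 1 \<le> 2 * (k - 1)")
      case True
      then show ?thesis using c pq by (auto simp: max_def)
    next
      case False
      then have "p = k - 1" "q = k - 1" using pq by auto
      then show ?thesis using c pq by (auto simp: max_def)
    qed
    moreover have "(\<Sum>j<2. max k (card (met_unit_cells m (t j) (t (Suc j))))) =
       max k (card (met_unit_cells m 0 s)) + max k (card (met_unit_cells m s (real m)))"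
      by (simp add: numeral_2_eq_2 t_def)
    ultimately show ?thesis using m1 m2 by linarith
  qed
  show "\<exists>Z. allocation 2 (\<Union>\<I>) Z \<and> feasible k 2 \<I> Z \<and>
        (\<forall>i<2. (\<forall>j<2. measure (\<mu> i) (Z j) \<le> measure (\<mu> i) (Z i) + \<delta>) \<and>
           real k / real (max (2 * k) (m + 1)) * measure (\<mu> i) (\<Union>\<I>) \<le> measure (\<mu> i) (Z i) + \<delta>)"
  proof (rule allocation_of_cut[OF C e \<open>m > 0\<close> \<mu> t(1) t(5) _ \<pi> _ D])
    show "t j \<le> t (Suc j)" if "j < 2" for j
      using that s by (auto simp: t_def)
    show "atomless_finite_measure.bundle_value (\<mu> i) m k a (t j) (t (Suc j))
       \<le> atomless_finite_measure.bundle_value (\<mu> i) m k a (t (\<pi> i)) (t (Suc (\<pi> i))) + \<delta>" if "i < 2" "j < 2" for i j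
      using env[OF that] by (simp add: U_def)
  qed (use \<open>\<delta> > 0\<close> in auto)
qed

section \<open>Upper bounds\<close>

text \<open>
  The density that all agents share in the extremal example: the first island is worth \<open>2\<close> and each
  other one \<open>1\<close>.
\<close>
definition heavy_first_density :: "real \<Rightarrow> real" where
  "heavy_first_density x = (if x < 1 then 2 else 1)"

definition consecutive_islands :: "nat \<Rightarrow> real set set" where
  "consecutive_islands m = (\<lambda>l. {real l..<real l + 1}) ` {..<m}"

lemma consecutive_islands_inj: "inj_on (\<lambda>l. {real l..<real l + 1}) {..<m}"
proof (rule inj_onI)
  fix l l' assume eq: "{real l..<real l + 1} = {real l'..<real l' + 1}"
  have "real l \<in> {real l..<real l + 1}" "real l' \<in> {real l'..<real l' + 1}" by auto
  then have "real l \<in> {real l'..<real l' + 1}" "real l' \<in> {real l..<real l + 1}" using eq by blast+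
  then show "l = l'" by auto
qed

lemma multicake_consecutive_islands: "multicake m (consecutive_islands m)"
proof -
  have "disjoint (consecutive_islands m)"
    unfolding consecutive_islands_def
  proof (rule disjoint_family_on_disjoint_image)
    show "disjoint_family_on (\<lambda>l. {real l..<real l + 1}) {..<m}"
      unfolding disjoint_family_on_def
    proof (intro ballI impI)
      fix l l' :: nat assume "l \<noteq> l'"
      then have "real l + 1 \<le> real l' \<or> real l' + 1 \<le> real l" by linarith
      then show "{real l..<real l + 1} \<inter> {real l'..<real l' + 1} = {}" by auto
    qed
  qed
  then show ?thesis
    using card_image[OF consecutive_islands_inj, of m]
    by (auto simp: multicake_def consecutive_islands_def is_interval_1)
qed

text \<open>
  An agent can get more than \<open>k\<close> from \<open>k\<close> intervals only if more than \<open>1\<close> comes from the first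
  island. That island is worth \<open>2\<close>, so two agents cannot both get more than \<open>k\<close>, out of a total of
  \<open>m + 1\<close>. The first bound serves to make the set of guaranteed ratios bounded for every \<open>n\<close>.
\<close>
lemma guaranteed_upper_bounds:
  assumes "m > 0" "n > 0" and g: "guaranteed m k n r"
  shows "r \<le> 1" and "n = 2 \<Longrightarrow> r \<le> 1 / 2" and "n = 2 \<Longrightarrow> k > 0 \<Longrightarrow> r \<le> real k / real (m + 1)"
proof -
  let ?I = "\<lambda>l::nat. {real l..<real l + 1}"
  define \<I> where "\<I> = consecutive_islands m"
  have C: "multicake m \<I>" unfolding \<I>_def by (rule multicake_consecutive_islands)
  define C where "C = \<Union>\<I>"
  have CL: "C \<in> sets lebesgue" unfolding C_def by (rule multicake_Union_sets_lebesgue[OF C])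
  have enum: "bij_betw ?I {..<m} \<I>"
    unfolding \<I>_def consecutive_islands_def by (rule inj_on_imp_bij_betw[OF consecutive_islands_inj])
  have IC: "?I l \<subseteq> C" if "l < m" for l using that by (auto simp: C_def \<I>_def consecutive_islands_def)
  have IL: "?I l \<in> sets lebesgue" for l by (simp add: sets_completionI_sets)
  define V where "V Z = (LINT x:Z|lebesgue. heavy_first_density x)" for Z
  have "set_integrable lebesgue C heavy_first_density"
  proof -
    have "C \<subseteq> {0..real m}" by (force simp: C_def \<I>_def consecutive_islands_def)
    moreover have "set_integrable lebesgue {0..real m} heavy_first_density"
      unfolding set_integrable_def
    proof (rule integrableI_bounded_set[where A = "{0..real m}" and B = 2])
      show "(\<lambda>x. indicat_real {0..real m} x *\<^sub>R heavy_first_density x) \<in> borel_measurable lebesgue"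
        unfolding heavy_first_density_def by (intro measurable_completion) simp
    qed (auto simp: heavy_first_density_def)
    ultimately show ?thesis using set_integrable_subset CL by blast
  qed
  then have vm: "value_measure C V"
    unfolding value_measure_def V_def by (intro exI[of _ heavy_first_density]) (auto simp: heavy_first_density_def)
  then obtain M where M: "atomless_finite_measure M" and VM: "\<And>Z. Z \<in> sets lebesgue \<Longrightarrow> Z \<subseteq> C \<Longrightarrow> V Z = measure M Z"
    using atomless_finite_measure_of_value_measure[OF vm CL] by blast
  interpret atomless_finite_measure M by (rule M)
  have value_island: "measure M (?I l) = (if l = 0 then 2 else 1)" if "l < m" for l
  proof -
    have "measure M (?I l) = V (?I l)" using VM[OF IL IC[OF that]] by simp
    also have "\<dots> = (LINT x:?I l|lebesgue. if l = 0 then 2 else 1)"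
      unfolding V_def using IL by (intro set_lebesgue_integral_cong) (auto simp: heavy_first_density_def)
    also have "\<dots> = (if l = 0 then 2 else 1)"
      by (simp add: set_lebesgue_integral_def)
    finally show ?thesis .
  qed
  have "measure M C = (\<Sum>l<m. if l = 0 then 2 else 1)"
    unfolding C_def measure_multicake[OF C enum] by (intro sum.cong value_island) auto
  also have "\<dots> = real m + 1"
    using \<open>m > 0\<close> by (cases m) (simp_all add: sum.lessThan_Suc_shift del: sum.lessThan_Suc)
  finally have MC: "measure M C = real m + 1" .
  obtain Z where Z: "allocation n C Z" "feasible k n \<I> Z" and val: "\<And>i. i < n \<Longrightarrow> V (Z i) \<ge> r * V C"
    using g[unfolded guaranteed_def, rule_format, of \<I> "\<lambda>_. V"] C vm unfolding C_def by blast
  have ZL: "Z i \<in> sets lebesgue" if "i < n" for i using feasible_sets_lebesgue[OF C Z(2) that] .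
  have ZC: "Z i \<subseteq> C" if "i < n" for i using Z(1) that by (simp add: allocation_def)
  have share: "r * (real m + 1) \<le> measure M (Z i)" if "i < n" for i
    using val[OF that] VM[OF ZL[OF that] ZC[OF that]] VM[OF CL] MC by simp
  have "measure M (Z 0) \<le> measure M C" using ZC[of 0] CL \<open>n > 0\<close> by (intro finite_measure_mono) auto
  then have "r * (real m + 1) \<le> 1 * (real m + 1)"
    unfolding MC mult_1 by (rule order_trans[OF share[OF \<open>n > 0\<close>]])
  then show "r \<le> 1" by (rule mult_right_le_imp_le) simp
  have disj: "Z 0 \<inter> Z 1 = {}" if "n = 2" using Z(1) that by (auto simp: allocation_def disjoint_family_on_def)
  show "r \<le> 1 / 2" if n: "n = 2"
  proof -
    have "measure M (Z 0) + measure M (Z 1) = measure M (Z 0 \<union> Z 1)"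
      using ZL disj n by (intro finite_measure_Union[symmetric]) auto
    also have "\<dots> \<le> real m + 1" unfolding MC[symmetric] using ZC n CL by (intro finite_measure_mono) auto
    finally have "(2 * r) * (real m + 1) \<le> 1 * (real m + 1)" using share[of 0] share[of 1] n by (simp add: algebra_simps)
    then have "2 * r \<le> 1" by (rule mult_right_le_imp_le) simp
    then show ?thesis by simp
  qed
  show "r \<le> real k / real (m + 1)" if n: "n = 2" and "k > 0"
  proof (rule ccontr)
    assume "\<not> r \<le> real k / real (m + 1)"
    then have big: "real k < r * (real m + 1)" by (simp add: field_simps)
    have heavy: "measure M (Z i \<inter> ?I 0) > 1" if i: "i < n" for i
    proof (rule ccontr)
      assume "\<not> ?thesis"
      then have light: "measure M (Z i \<inter> ?I 0) \<le> 1" by simp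
      obtain \<J> where J: "finite \<J>" "card \<J> \<le> k" "\<And>J. J \<in> \<J> \<Longrightarrow> is_interval J \<and> (\<exists>I\<in>\<I>. J \<subseteq> I)" "Z i = \<Union>\<J>"
        using Z(2)[unfolded feasible_def, rule_format, OF i] by (elim exE conjE) (rule that, auto)
      have JL: "J \<in> sets lebesgue" if "J \<in> \<J>" for J
      proof -
        have "feasible 1 1 \<I> (\<lambda>_. J)"
          unfolding feasible_def using J(3)[OF that] by (intro allI impI exI[of _ "{J}"]) auto
        from feasible_sets_lebesgue[OF C this, of 0] show ?thesis by simp
      qed
      define \<J>0 where "\<J>0 = {J \<in> \<J>. J \<subseteq> ?I 0}"
      have one: "measure M J \<le> 1" if "J \<in> \<J> - \<J>0" for J
      proof -
        have "J \<in> \<J>" using that by blast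
        from J(3)[OF this] obtain l where l: "l < m" "J \<subseteq> ?I l" by (auto simp: \<I>_def consecutive_islands_def)
        then have "l \<noteq> 0" using that by (auto simp: \<J>0_def)
        then show ?thesis using finite_measure_mono[OF l(2)] IL[of l] value_island[OF l(1)] by simp
      qed
      have "measure M (Z i) \<le> measure M (\<Union>\<J>0 \<union> \<Union>(\<J> - \<J>0))"
        unfolding J(4) using JL J(1) by (intro finite_measure_mono) (auto simp: \<J>0_def intro!: sets.Un sets.finite_Union)
      also have "\<dots> \<le> measure M (\<Union>\<J>0) + measure M (\<Union>(\<J> - \<J>0))"
        using JL J(1) by (intro measure_Un_le) (auto simp: \<J>0_def intro!: sets.finite_Union)
      also have "measure M (\<Union>(\<J> - \<J>0)) \<le> (\<Sum>J\<in>\<J> - \<J>0. measure M J)"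
        using measure_UNION_le[of "\<J> - \<J>0" "\<lambda>J. J" M] J(1) JL by simp
      also have "\<dots> \<le> (\<Sum>J\<in>\<J> - \<J>0. 1)" by (intro sum_mono one)
      finally have le: "measure M (Z i) \<le> measure M (\<Union>\<J>0) + real (card (\<J> - \<J>0))" by simp
      have "measure M (Z i) \<le> real k"
      proof (cases "\<J>0 = {}")
        case True
        then show ?thesis using le J(2) by simp
      next
        case False
        have "measure M (\<Union>\<J>0) \<le> measure M (Z i \<inter> ?I 0)"
          using IL[of 0] ZL[OF i] by (intro finite_measure_mono) (auto simp: J(4) \<J>0_def)
        moreover have "card (\<J> - \<J>0) < card \<J>"
          using False J(1) by (intro psubset_card_mono) (auto simp: \<J>0_def)
        ultimately show ?thesis using le light J(2) by linarith
      qed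
      then show False using share[OF i] big by linarith
    qed
    have "measure M (Z 0 \<inter> ?I 0) + measure M (Z 1 \<inter> ?I 0) = measure M (Z 0 \<inter> ?I 0 \<union> Z 1 \<inter> ?I 0)"
      using ZL IL[of 0] disj n by (intro finite_measure_Union[symmetric]) auto
    also have "\<dots> \<le> measure M (?I 0)" using IL[of 0] by (intro finite_measure_mono) auto
    also have "\<dots> = 2" using value_island[of 0] \<open>m > 0\<close> by simp
    finally show False using heavy[of 0] heavy[of 1] n by simp
  qed
qed

section \<open>The largest guaranteed ratio\<close>

text \<open>
  The supremum of the guaranteed ratios is attained, since on each multicake it can be approached up to
  any \<open>\<delta>\<close>.
\<close>
lemma guaranteed_r\<^sub>E:
  assumes "m > 0" "n > 0" and g: "guaranteed m k n r\<^sub>0"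
  shows "guaranteed m k n (r\<^sub>E m k n)" and "r\<^sub>0 \<le> r\<^sub>E m k n"
proof -
  define G where "G = {r. guaranteed m k n r}"
  have bdd: "bdd_above G" unfolding G_def using guaranteed_upper_bounds(1)[OF assms(1,2)] by (intro bdd_aboveI[of _ 1]) auto
  have ne: "G \<noteq> {}" using g by (auto simp: G_def)
  have "guaranteed m k n (Sup G)"
  proof (rule guaranteedI[OF \<open>m > 0\<close>])
    fix \<I> V \<mu> and \<delta> :: real
    assume C: "multicake m \<I>" and V: "\<forall>i<n. value_measure (\<Union>\<I>) (V i)"
      and \<mu>: "\<And>i. i < n \<Longrightarrow> atomless_finite_measure (\<mu> i)"
      and V\<mu>: "\<And>i Z. i < n \<Longrightarrow> Z \<in> sets lebesgue \<Longrightarrow> Z \<subseteq> \<Union>\<I> \<Longrightarrow> V i Z = measure (\<mu> i) Z" and "\<delta> > 0"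
    \<comment> \<open>The error of the ratio is scaled so that it costs no agent more than \<open>\<delta>\<close>.\<close>
    define W where "W = 1 + (\<Sum>i<n. measure (\<mu> i) (\<Union>\<I>))"
    have W: "W > 0" unfolding W_def by (intro add_pos_nonneg sum_nonneg) auto
    have "Sup G - \<delta> / W < Sup G" using \<open>\<delta> > 0\<close> W by simp
    then obtain r where "r \<in> G" and r: "Sup G - \<delta> / W < r" using less_cSup_iff[OF ne bdd] by blast
    then obtain Z where Z: "allocation n (\<Union>\<I>) Z" "feasible k n \<I> Z" "envy_free n V Z"
      and val: "\<forall>i<n. V i (Z i) \<ge> r * V i (\<Union>\<I>)"
      using C V unfolding G_def guaranteed_def by blast
    have VZ: "V i (Z j) = measure (\<mu> i) (Z j)" if "i < n" "j < n" for i j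
      using V\<mu>[OF that(1) feasible_sets_lebesgue[OF C Z(2) that(2)]] Z(1) that(2) by (auto simp: allocation_def)
    have VC: "V i (\<Union>\<I>) = measure (\<mu> i) (\<Union>\<I>)" if "i < n" for i
      using V\<mu>[OF that multicake_Union_sets_lebesgue[OF C]] by simp
    have "Sup G * measure (\<mu> i) (\<Union>\<I>) \<le> measure (\<mu> i) (Z i) + \<delta>" if i: "i < n" for i
    proof -
      let ?c = "measure (\<mu> i) (\<Union>\<I>)"
      have "?c \<le> (\<Sum>i<n. measure (\<mu> i) (\<Union>\<I>))" using i by (intro member_le_sum) auto
      then have "\<delta> / W * ?c \<le> \<delta> / W * W" using \<open>\<delta> > 0\<close> W by (intro mult_left_mono) (auto simp: W_def)
      moreover have "Sup G * ?c \<le> (r + \<delta> / W) * ?c" using r by (intro mult_right_mono) auto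
      moreover have "r * ?c \<le> measure (\<mu> i) (Z i)" using val i VZ VC by simp
      ultimately show ?thesis using W by (simp add: distrib_right)
    qed
    moreover have "measure (\<mu> i) (Z j) \<le> measure (\<mu> i) (Z i) + \<delta>" if "i < n" "j < n" for i j
      using Z(3) VZ that \<open>\<delta> > 0\<close> unfolding envy_free_def by (smt (verit))
    ultimately show "\<exists>Z. allocation n (\<Union>\<I>) Z \<and> feasible k n \<I> Z \<and>
      (\<forall>i<n. (\<forall>j<n. measure (\<mu> i) (Z j) \<le> measure (\<mu> i) (Z i) + \<delta>) \<and> Sup G * measure (\<mu> i) (\<Union>\<I>) \<le> measure (\<mu> i) (Z i) + \<delta>)"
      using Z(1,2) by blast
  qed
  then have "r\<^sub>E m k n = Sup G"
    unfolding r\<^sub>E_def using cSup_upper[OF _ bdd] by (intro Greatest_equality) (auto simp: G_def)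
  then show "guaranteed m k n (r\<^sub>E m k n)" "r\<^sub>0 \<le> r\<^sub>E m k n"
    using \<open>guaranteed m k n (Sup G)\<close> cSup_upper[OF _ bdd, of r\<^sub>0] g by (auto simp: G_def)
qed

theorem theorem3:
  fixes m k n :: nat
  assumes "m \<ge> 1" and "k \<ge> 1"
  shows "(n = 2 \<longrightarrow> r\<^sub>E m k n = min (1 / real n) (real k / (real m + real n - 1))) \<and>
         (n \<ge> 3 \<longrightarrow> r\<^sub>E m k n \<ge> min (1 / real n) (real k / (real m + real n * real k - real k)))"
proof (intro conjI impI)
  have pos: "m > 0" "k > 0" using assms by auto
  assume n: "n = 2"
  have g: "guaranteed m k n (real k / real (max (2 * k) (m + 1)))"
    using guaranteed_two[OF pos] n by simp
  have "r\<^sub>E m k n = min (1 / 2) (real k / real (m + 1))"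
  proof (rule antisym)
    have "guaranteed m k n (r\<^sub>E m k n)" using guaranteed_r\<^sub>E(1)[OF pos(1) _ g] n by simp
    then show "r\<^sub>E m k n \<le> min (1 / 2) (real k / real (m + 1))"
      using guaranteed_upper_bounds(2,3)[OF pos(1), of n k] n pos by simp
    have "min (real k / real (2 * k)) (real k / real (m + 1)) \<le> real k / real (max (2 * k) (m + 1))"
      by (simp add: max_def)
    moreover have "real k / real (2 * k) = 1 / 2" using pos by simp
    ultimately show "min (1 / 2) (real k / real (m + 1)) \<le> r\<^sub>E m k n"
      using guaranteed_r\<^sub>E(2)[OF pos(1) _ g] n by simp
  qed
  then show "r\<^sub>E m k n = min (1 / real n) (real k / (real m + real n - 1))" using n by (simp add: add.commute)
next
  have pos: "m > 0" "k > 0" using assms by auto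
  assume n: "n \<ge> 3"
  have eq: "real (m + (n - 1) * k) = real m + real n * real k - real k"
    using n by (cases n) (simp_all add: algebra_simps)
  have "real k / real (max (n * k) (m + (n - 1) * k)) \<le> r\<^sub>E m k n"
    using n pos by (intro guaranteed_r\<^sub>E(2) guaranteed_general) auto
  moreover have "min (real k / real (n * k)) (real k / real (m + (n - 1) * k)) \<le> real k / real (max (n * k) (m + (n - 1) * k))"
    by (simp add: max_def)
  moreover have "real k / real (n * k) = 1 / real n" using pos by simp
  ultimately show "r\<^sub>E m k n \<ge> min (1 / real n) (real k / (real m + real n * real k - real k))"
    unfolding eq by linarith
qed

end
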